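(* Let $\mathcal{Z}$ be an arc diagram and let $(h,s,t)$ be twisted H-data on $\mathcal{Z}$ with $L\ge0$ all-on doubly occupied pairs and $N\ge1$ all-on once occupied pairs. Let $n\ge 0$. Then the set of $\mathbb{Z}_2$-module homomorphisms $\int:Z_n(h,s,t)\to\mathcal{A}_{n+1}(h,s,t)$ inverting the differential (i.e. such that $x=\partial\int x$ for all $x\in Z_n(h,s,t)$) is an affine $\mathbb{Z}_2$ vector space of dimension $$\left[\sum_k\binom{L}{k}\binom{N+k-1}{n}\right]\left[\sum_k\binom{L}{k}\binom{N+k-1}{n+1}\right],$$ while the set of linear combinations of creation operators (on $\mathcal{A}(h,s,t)$) is a $\mathbb{Z}_2$ vector space of dimension $N$.
   Context: All algebra is over $\mathbb{Z}_2$. An arc diagram $\mathcal{Z}=(\mathbf{Z},\mathbf{a},r)$ consists of oriented intervals $\mathbf{Z}=\{Z_1,\dots,Z_l\}$, distinct points $\mathbf{a}=(a_1,\dots,a_{2k})$ (places) in the interiors of the intervals, ordered along them, and a 2-to-1 map $r:\mathbf{a}\to\{1,\dots,k\}$ such that oriented surgery on $\mathbf{Z}$ at all $0$-spheres $r^{-1}(i)$ yields a 1-manifold with no circle components. The fibres $P=\{p,q\}$ of $r$ are the matched pairs, identified with $1,\dots,k$. Let $-\infty_i,+\infty_i$ be the start and end of $Z_i$ and $\mathbf{a}_{\pm\infty}=\mathbf{a}\cup\{\pm\infty_i\}$, partially ordered along the intervals; the places cut the intervals into steps. A strand diagram is a triple $(S,T,\phi)$ with $S,T\subseteq\mathbf{a}_{\pm\infty}$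 and $\phi:S\to T$ a bijection with $\phi(x)\ge x$; it is drawn as strands in $[0,1]\times\mathbf{Z}$ from $\{0\}\times S$ to $\{1\}\times T$, meeting efficiently; crossings are inversions ($x<y$ with $\phi(x)>\phi(y)$). The product of $(S,T,\phi)$ and $(U,V,\psi)$ is $(S,V,\psi\phi)$ if $T=U$ and the numbers of inversions satisfy $\mathrm{inv}(\psi\phi)=\mathrm{inv}(\phi)+\mathrm{inv}(\psi)$, and $0$ otherwise; $\partial$ is the sum of all resolutions of one crossing which lower the number of crossings by exactly $1$. $I(S)$ is the identity diagram on $S$. For a set $s$ of matched pairs let $I(s)=\sum_S I(S)$, over all $S\subseteq \mathbf{a}_{\pm\infty}$ consisting of exactly one place of each pair in $s$, no other places, and any subset of $\{\pm\infty_i\}$. For $\mu=(S,T,\phi)$ without horizontal strands (fixed points) let $a(\mu)=\sum_U(S\cup U,T\cup U,\phi_U)$ over $U\subseteq\mathbf{a}_{\pm\infty}\setminus(S\cup T)$, $\phi_U$ extending $\phi$ by the identity. A diagram from $s$ to $t$ is a nonzero element $I(s)a(\mu)I(t)$; it is drawn as one picture with dotted horizontal strands at both places $p,q$ of every matched pair carrying a horizontal strand. The (augmented) strand algebra $\mathcal{A}=\mathcal{A}(\mathcal{Z})$ is the DGA with basis the diagrams. H-data is a triple $(h,s,t)$ with $h\in H_1(\mathbf{Z},\mathbf{a}_{\pm\infty})$ and $s,t$ sets of matched pairs. A diagram from $s$ to $t$ has H-data $(h,s,t)$, $h=\sum_x[x,\phi(x)]$; $\mathcal{A}(h,s,t)$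 is the span of diagrams with this H-data (a subcomplex). $h$ (and any H-data or diagram with H-grading $h$) is viable if $h$ has multiplicity $0$ or $1$ on every step. In a viable diagram every crossing involves a horizontal strand, hence lies at a matched pair. A viable diagram is twisted if it has no crossings and is zero in the homology of $\mathcal{A}$. Viable H-data is twisted if some twisted diagram has that H-data. A matched pair $P=\{p,q\}$ is all-on for $(h,s,t)$ if $P\in s$ and $P\in t$; it is once occupied at $p$ if $h$ covers both steps adjacent to $p$ and neither step adjacent to $q$; it is doubly occupied if $h$ covers all four of these steps. For viable $(h,s,t)$, $\mathcal{A}_n(h,s,t)\subseteq\mathcal{A}(h,s,t)$ is the span of the diagrams with crossings at precisely $n$ matched pairs, and $Z_n(h,s,t)\subseteq\mathcal{A}_n(h,s,t)$ is the subspace of cycles. For each all-on once occupied pair $P=\{p,q\}$ (occupied at $p$) the creation operator $A_P^*:\mathcal{A}(h,s,t)\to\mathcal{A}(h,s,t)$ is the linear map with $A_P^*D=0$ for diagrams $D$ with a crossing at $P$; otherwise one strand of $D$ ends at $p$ and another begins at $p$, and $A_P^*D$ is obtained by joining these into a single strand running past $p$ and adding dotted horizontal strands at $p$ and $q$. Sums are over all integers $k$; $\binom{a}{b}=0$ when $b<0$ or $b>a$. *)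

theory Defs
  imports Complex_Main "HOL-Library.Function_Algebras" "HOL-Library.Z2"
begin

section \<open>Arc diagrams\<close>

text \<open>
  An arc diagram enters only through the order of the places along the intervals, so it is
  recorded combinatorially: the intervals are \<open>1, \<dots>, l\<close>, and on the interval \<open>i\<close> the pair
  \<open>(i, j)\<close> is the start \<open>-\<infinity>\<^sub>i\<close> for \<open>j = 0\<close>, the \<open>j\<close>-th place for \<open>1 \<le> j \<le> num_places Z i\<close>,
  and the end \<open>+\<infinity>\<^sub>i\<close> for \<open>j = num_places Z i + 1\<close>. Matched pairs are identified with the values
  \<open>1, \<dots>, k\<close> of the 2-to-1 map \<open>label\<close> (written \<open>r\<close> in the literature).
\<close>

type_synonym point = "nat \<times> nat"

record arc =
  num_intervals :: nat
  num_places :: "nat \<Rightarrow> nat"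
  num_pairs :: nat
  label :: "point \<Rightarrow> nat"

definition points :: "arc \<Rightarrow> point set" where
  "points Z = {(i, j). i \<in> {1..num_intervals Z} \<and> j \<le> num_places Z i + 1}"

definition places :: "arc \<Rightarrow> point set" where
  "places Z = {(i, j). i \<in> {1..num_intervals Z} \<and> 1 \<le> j \<and> j \<le> num_places Z i}"

text \<open>The step \<open>(i, j)\<close> runs from the point \<open>(i, j)\<close> to the point \<open>(i, j + 1)\<close>.\<close>

definition steps :: "arc \<Rightarrow> (nat \<times> nat) set" where
  "steps Z = {(i, j). i \<in> {1..num_intervals Z} \<and> j \<le> num_places Z i}"

definition step_before :: "point \<Rightarrow> nat \<times> nat" where
  "step_before p = (fst p, snd p - 1)"

definition step_after :: "point \<Rightarrow> nat \<times> nat" where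
  "step_after p = p"

definition pairs :: "arc \<Rightarrow> nat set" where
  "pairs Z = {1..num_pairs Z}"

definition places_of :: "arc \<Rightarrow> nat \<Rightarrow> point set" where
  "places_of Z P = {p \<in> places Z. label Z p = P}"

text \<open>
  Oriented surgery at a matched pair \<open>{p, q}\<close> cuts the intervals at \<open>p\<close> and \<open>q\<close> and glues the
  step arriving at \<open>p\<close> to the step leaving \<open>q\<close>, and vice versa. Hence the surgered manifold has
  a circle component iff the following successor relation on steps has a cycle.
\<close>

definition surgery_succ :: "arc \<Rightarrow> ((nat \<times> nat) \<times> (nat \<times> nat)) set" where
  "surgery_succ Z = {(step_before p, step_after q) | p q.
     p \<in> places Z \<and> q \<in> places Z \<and> p \<noteq> q \<and> label Z p = label Z q}"

definition arc_diagram :: "arc \<Rightarrow> bool" where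
  "arc_diagram Z \<longleftrightarrow>
     label Z ` places Z \<subseteq> pairs Z \<and>
     (\<forall>P\<in>pairs Z. card (places_of Z P) = 2) \<and>
     acyclic (surgery_succ Z)"

definition point_le :: "point \<Rightarrow> point \<Rightarrow> bool" where
  "point_le x y \<longleftrightarrow> fst x = fst y \<and> snd x \<le> snd y"

definition point_less :: "point \<Rightarrow> point \<Rightarrow> bool" where
  "point_less x y \<longleftrightarrow> fst x = fst y \<and> snd x < snd y"


section \<open>Strand diagrams and their chains\<close>

text \<open>
  A strand diagram \<open>(S, T, \<phi>)\<close> is represented by the graph of \<open>\<phi>\<close>; \<open>S\<close> and \<open>T\<close> are its \<open>Domain\<close>
  and \<open>Range\<close>. The two \<open>single_valued\<close> conditions say that it is the graph of a bijection.
\<close>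

type_synonym strands = "(point \<times> point) set"

definition strand_diagrams :: "arc \<Rightarrow> strands set" where
  "strand_diagrams Z = {D. D \<subseteq> points Z \<times> points Z \<and> single_valued D \<and> single_valued (D\<inverse>) \<and>
     (\<forall>(x, y)\<in>D. point_le x y)}"

definition inversions :: "strands \<Rightarrow> ((point \<times> point) \<times> (point \<times> point)) set" where
  "inversions D = {((x, x'), (y, y')) | x x' y y'.
     (x, x') \<in> D \<and> (y, y') \<in> D \<and> point_less x y \<and> point_less y' x'}"

definition inv_number :: "strands \<Rightarrow> nat" where
  "inv_number D = card (inversions D)"

text \<open>
  Chains are formal \<open>\<int>\<^sub>2\<close>-combinations of strand diagrams, given by their coefficient functions.
  Addition of chains, and of maps between them, is pointwise.
\<close>

type_synonym chain = "strands \<Rightarrow> bit"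

definition chain_scale :: "bit \<Rightarrow> chain \<Rightarrow> chain" where
  "chain_scale c v = (\<lambda>D. c * v D)"

definition map_scale :: "bit \<Rightarrow> (chain \<Rightarrow> chain) \<Rightarrow> (chain \<Rightarrow> chain)" where
  "map_scale c f = (\<lambda>v. chain_scale c (f v))"

global_interpretation chain: vector_space chain_scale
  by unfold_locales
    (simp_all only: chain_scale_def fun_eq_iff plus_fun_apply ring_distribs mult.assoc mult_1_left simp_thms)

global_interpretation chain_map: vector_space map_scale
  by unfold_locales
    (simp_all only: map_scale_def chain_scale_def fun_eq_iff plus_fun_apply ring_distribs mult.assoc
      mult_1_left simp_thms)

definition single :: "strands \<Rightarrow> chain" where
  "single D = (\<lambda>E. if E = D then 1 else 0)"

text \<open>Since \<open>(x, z) \<in> D O E\<close> iff \<open>(x, y) \<in> D\<close> and \<open>(y, z) \<in> E\<close> for some \<open>y\<close>, the strands of \<open>D\<close>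
  come first in \<open>D O E\<close>, as required.\<close>

definition strand_mult :: "strands \<Rightarrow> strands \<Rightarrow> chain" where
  "strand_mult D E =
     (if Range D = Domain E \<and> inv_number (D O E) = inv_number D + inv_number E
      then single (D O E) else 0)"

definition chain_mult :: "arc \<Rightarrow> chain \<Rightarrow> chain \<Rightarrow> chain" where
  "chain_mult Z v w =
     (\<Sum>D\<in>strand_diagrams Z. \<Sum>E\<in>strand_diagrams Z. chain_scale (v D * w E) (strand_mult D E))"

fun resolve :: "strands \<Rightarrow> (point \<times> point) \<times> (point \<times> point) \<Rightarrow> strands" where
  "resolve D ((x, x'), (y, y')) = (D - {(x, x'), (y, y')}) \<union> {(x, y'), (y, x')}"

definition strand_diff :: "strands \<Rightarrow> chain" where
  "strand_diff D =
     (\<Sum>c\<in>{c \<in> inversions D. inv_number D = inv_number (resolve D c) + 1}. single (resolve D c))"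

definition diff :: "arc \<Rightarrow> chain \<Rightarrow> chain" where
  "diff Z v = (\<Sum>D\<in>strand_diagrams Z. chain_scale (v D) (strand_diff D))"


section \<open>The augmented strand algebra\<close>

definition sections :: "arc \<Rightarrow> nat set \<Rightarrow> point set set" where
  "sections Z s = {S. S \<subseteq> points Z \<and> (\<forall>P\<in>s. \<exists>!p. p \<in> S \<inter> places_of Z P) \<and>
     label Z ` (S \<inter> places Z) \<subseteq> s}"

definition idem :: "arc \<Rightarrow> nat set \<Rightarrow> chain" where
  "idem Z s = (\<Sum>S\<in>sections Z s. single (Id_on S))"

definition moving_strands :: "arc \<Rightarrow> strands set" where
  "moving_strands Z = {\<mu> \<in> strand_diagrams Z. \<forall>x. (x, x) \<notin> \<mu>}"

definition add_horizontals :: "arc \<Rightarrow> strands \<Rightarrow> chain" where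
  "add_horizontals Z \<mu> =
     (\<Sum>U\<in>Pow (points Z - (Domain \<mu> \<union> Range \<mu>)). single (\<mu> \<union> Id_on U))"

definition diagram :: "arc \<Rightarrow> nat set \<Rightarrow> strands \<Rightarrow> nat set \<Rightarrow> chain" where
  "diagram Z s \<mu> t = chain_mult Z (chain_mult Z (idem Z s) (add_horizontals Z \<mu>)) (idem Z t)"

definition strand_algebra :: "arc \<Rightarrow> chain set" where
  "strand_algebra Z = chain.span {diagram Z s \<mu> t | s \<mu> t.
     s \<subseteq> pairs Z \<and> t \<subseteq> pairs Z \<and> \<mu> \<in> moving_strands Z \<and> diagram Z s \<mu> t \<noteq> 0}"


section \<open>H-data\<close>

text \<open>
  Relative to all the points \<open>points Z\<close>, the first homology (with integer coefficients) of the
  intervals is free abelian on the steps; a class is represented by its multiplicities.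
\<close>

type_synonym hclass = "nat \<times> nat \<Rightarrow> int"

definition H1 :: "arc \<Rightarrow> hclass set" where
  "H1 Z = {h. \<forall>e. e \<notin> steps Z \<longrightarrow> h e = 0}"

definition segment_class :: "point \<Rightarrow> point \<Rightarrow> hclass" where
  "segment_class x y =
     (\<lambda>e. if fst e = fst x \<and> fst e = fst y \<and> snd x \<le> snd e \<and> snd e < snd y then 1 else 0)"

definition hgrading :: "strands \<Rightarrow> hclass" where
  "hgrading \<mu> = (\<Sum>(x, y)\<in>\<mu>. segment_class x y)"

definition hdata :: "arc \<Rightarrow> hclass \<Rightarrow> nat set \<Rightarrow> nat set \<Rightarrow> bool" where
  "hdata Z h s t \<longleftrightarrow> h \<in> H1 Z \<and> s \<subseteq> pairs Z \<and> t \<subseteq> pairs Z"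

definition viable :: "arc \<Rightarrow> hclass \<Rightarrow> bool" where
  "viable Z h \<longleftrightarrow> (\<forall>e\<in>steps Z. h e = 0 \<or> h e = 1)"

definition moving_strands_of :: "arc \<Rightarrow> hclass \<Rightarrow> nat set \<Rightarrow> nat set \<Rightarrow> strands set" where
  "moving_strands_of Z h s t =
     {\<mu> \<in> moving_strands Z. hgrading \<mu> = h \<and> diagram Z s \<mu> t \<noteq> 0}"

definition diagrams :: "arc \<Rightarrow> hclass \<Rightarrow> nat set \<Rightarrow> nat set \<Rightarrow> chain set" where
  "diagrams Z h s t = (\<lambda>\<mu>. diagram Z s \<mu> t) ` moving_strands_of Z h s t"

definition algebra_part :: "arc \<Rightarrow> hclass \<Rightarrow> nat set \<Rightarrow> nat set \<Rightarrow> chain set" where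
  "algebra_part Z h s t = chain.span (diagrams Z h s t)"


section \<open>Crossings and twistedness\<close>

text \<open>
  The single picture of a diagram is the superposition of the strand diagrams occurring in it,
  so its crossings are those of its summands.
\<close>

definition crossingless :: "chain \<Rightarrow> bool" where
  "crossingless v \<longleftrightarrow> (\<forall>D. v D \<noteq> 0 \<longrightarrow> inversions D = {})"

definition crossed_pairs :: "arc \<Rightarrow> chain \<Rightarrow> nat set" where
  "crossed_pairs Z v = {label Z p | p. p \<in> places Z \<and>
     (\<exists>D f. v D \<noteq> 0 \<and> (((p, p), f) \<in> inversions D \<or> (f, (p, p)) \<in> inversions D))}"

definition null_homologous :: "arc \<Rightarrow> chain \<Rightarrow> bool" where
  "null_homologous Z v \<longleftrightarrow> diff Z v = 0 \<and> v \<in> diff Z ` strand_algebra Z"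

definition twisted_hdata :: "arc \<Rightarrow> hclass \<Rightarrow> nat set \<Rightarrow> nat set \<Rightarrow> bool" where
  "twisted_hdata Z h s t \<longleftrightarrow> hdata Z h s t \<and> viable Z h \<and>
     (\<exists>v\<in>diagrams Z h s t. crossingless v \<and> null_homologous Z v)"


section \<open>Occupation of matched pairs\<close>

definition once_occupied_at :: "arc \<Rightarrow> hclass \<Rightarrow> nat \<Rightarrow> point \<Rightarrow> bool" where
  "once_occupied_at Z h P p \<longleftrightarrow> (\<exists>q. p \<noteq> q \<and> places_of Z P = {p, q} \<and>
     h (step_before p) = 1 \<and> h (step_after p) = 1 \<and>
     h (step_before q) = 0 \<and> h (step_after q) = 0)"

definition doubly_occupied :: "arc \<Rightarrow> hclass \<Rightarrow> nat \<Rightarrow> bool" where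
  "doubly_occupied Z h P \<longleftrightarrow>
     (\<forall>p\<in>places_of Z P. h (step_before p) = 1 \<and> h (step_after p) = 1)"

definition all_on_once :: "arc \<Rightarrow> hclass \<Rightarrow> nat set \<Rightarrow> nat set \<Rightarrow> nat set" where
  "all_on_once Z h s t = {P \<in> pairs Z. P \<in> s \<and> P \<in> t \<and> (\<exists>p. once_occupied_at Z h P p)}"

definition all_on_doubly :: "arc \<Rightarrow> hclass \<Rightarrow> nat set \<Rightarrow> nat set \<Rightarrow> nat set" where
  "all_on_doubly Z h s t = {P \<in> pairs Z. P \<in> s \<and> P \<in> t \<and> doubly_occupied Z h P}"


section \<open>Inverting the differential and creation operators\<close>

definition level :: "arc \<Rightarrow> hclass \<Rightarrow> nat set \<Rightarrow> nat set \<Rightarrow> nat \<Rightarrow> chain set" where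
  "level Z h s t n = chain.span {v \<in> diagrams Z h s t. card (crossed_pairs Z v) = n}"

definition level_cycles :: "arc \<Rightarrow> hclass \<Rightarrow> nat set \<Rightarrow> nat set \<Rightarrow> nat \<Rightarrow> chain set" where
  "level_cycles Z h s t n = {v \<in> level Z h s t n. diff Z v = 0}"

text \<open>
  Homomorphisms defined on a subspace \<open>V\<close> only are represented by their extension by zero outside
  \<open>V\<close> (not linear in general), which keeps pointwise addition and scaling.
\<close>

definition homs :: "chain set \<Rightarrow> chain set \<Rightarrow> (chain \<Rightarrow> chain) set" where
  "homs V W = {f. (\<forall>x\<in>V. f x \<in> W) \<and> (\<forall>x\<in>V. \<forall>y\<in>V. f (x + y) = f x + f y) \<and>
     (\<forall>c. \<forall>x\<in>V. f (chain_scale c x) = chain_scale c (f x)) \<and> (\<forall>x. x \<notin> V \<longrightarrow> f x = 0)}"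

definition inverting_homs ::
    "arc \<Rightarrow> hclass \<Rightarrow> nat set \<Rightarrow> nat set \<Rightarrow> nat \<Rightarrow> (chain \<Rightarrow> chain) set" where
  "inverting_homs Z h s t n =
     {f \<in> homs (level_cycles Z h s t n) (level Z h s t (n + 1)).
        \<forall>x\<in>level_cycles Z h s t n. x = diff Z (f x)}"

text \<open>Over \<open>\<int>\<^sub>2\<close> finite-dimensional means finite; finiteness is required because the library's
  \<open>dim\<close> of an infinite-dimensional space is \<open>0\<close>.\<close>

definition vector_space_of_dim :: "(chain \<Rightarrow> chain) set \<Rightarrow> nat \<Rightarrow> bool" where
  "vector_space_of_dim W d \<longleftrightarrow> chain_map.subspace W \<and> finite W \<and> chain_map.dim W = d"

definition affine_space_of_dim :: "(chain \<Rightarrow> chain) set \<Rightarrow> nat \<Rightarrow> bool" where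
  "affine_space_of_dim A d \<longleftrightarrow> (\<exists>f W. vector_space_of_dim W d \<and> A = (\<lambda>g. f + g) ` W)"

text \<open>
  Joining the strands that end and begin at \<open>p\<close>. The dotted horizontal strands at the pair of \<open>p\<close>
  need not be added by hand: in \<open>diagram\<close> they appear at each pair of \<open>s\<close> without a moving strand.
\<close>

definition join_at :: "point \<Rightarrow> strands \<Rightarrow> strands" where
  "join_at p \<mu> = {(x, y) \<in> \<mu>. x \<noteq> p \<and> y \<noteq> p} \<union> {(x, y). (x, p) \<in> \<mu> \<and> (p, y) \<in> \<mu>}"

definition create ::
    "arc \<Rightarrow> nat set \<Rightarrow> nat set \<Rightarrow> nat \<Rightarrow> point \<Rightarrow> strands \<Rightarrow> chain" where
  "create Z s t P p \<mu> =
     (if P \<in> crossed_pairs Z (diagram Z s \<mu> t) then 0 else diagram Z s (join_at p \<mu>) t)"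

text \<open>
  The linear extension of \<open>create\<close> from the basis \<open>diagrams Z h s t\<close>. As \<open>representation\<close> vanishes
  outside the span of the basis, this is again extended by zero outside \<open>algebra_part Z h s t\<close>.
\<close>

definition creation :: "arc \<Rightarrow> hclass \<Rightarrow> nat set \<Rightarrow> nat set \<Rightarrow> nat \<Rightarrow> chain \<Rightarrow> chain" where
  "creation Z h s t P = (\<lambda>v. \<Sum>\<mu>\<in>moving_strands_of Z h s t.
     chain_scale (chain.representation (diagrams Z h s t) v (diagram Z s \<mu> t))
       (create Z s t P (THE p. once_occupied_at Z h P p) \<mu>))"

end

theory Submission
  imports Defs "HOL-Library.FuncSet" "HOL-Library.Indicator_Function"
begin

text \<open>
  For a viable class the moving strands of a diagram are determined by the places at which one
  strand ends and another begins. The sets of such places that occur are exactly the sets of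
  vertices with pairwise distinct labels, where the vertices are the places of the all-on once or
  doubly occupied pairs that are covered on both sides, and the label of a place is its matched pair.
  In these terms the differential adds one vertex in all possible ways, and the number of crossed
  pairs is the number of missing labels. A creation operator removes the vertex of a pair having
  only one, and is a contracting homotopy. So the complex is exact, its cycles are counted
  recursively, and any two inverses of the differential differ by a homomorphism from cycles to
  cycles. All dimensions are read off from cardinalities. The creation operators are
  independent since they map a crossingless diagram to distinct diagrams.
\<close>

section \<open>Linear algebra over the field with two elements\<close>

text \<open>The faces form the join of N points, one for each all-on once occupied pair, with L
  pairs of points, one for each all-on doubly occupied pair. The differential is the coboundary of
  this join, the empty face included. N \<ge> 1 makes the join a cone, and its apex is the vertex
  removed by the contracting homotopy. Let a variable x count missing labels. A once occupied pair
  contributes 1 + x (vertex present or label missing), a doubly occupied pair 2 + x = 1 + (1 + x).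
  So the dimensions of the \<open>level\<close> spaces have generating function (1 + x)^N (2 + x)^L,
  which is the sum over k of (L choose k)(1 + x)^(N + k). By exactness this is 1 + x times the
  generating function of the cycles; cancelling the factor leaves the coefficients (N + k - 1 choose
  n) of the theorem. Twistedness enters through a crossingless diagram with the given H-data:
  joining and breaking its strands reaches every face, and it has a break at every label, so that
  every creation operator changes it in its own way.\<close>

lemma sum_fun_apply: "(\<Sum>i\<in>I. f i) x = (\<Sum>i\<in>I. f i x)"
  by (induction I rule: infinite_finite_induct) auto

text \<open>Instantiated for chains and for maps between chains. Both kinds of dimension are found
  by counting, since a finite space of dimension d has 2^d elements.\<close>

locale bit_vector_space = vector_space scale
  for scale :: "bit \<Rightarrow> 'b::ab_group_add \<Rightarrow> 'b"
begin

lemma add_self: "x + x = (0::'b)"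
proof -
  have "x + x = scale (1 + 1) x"
    by (simp only: scale_left_distrib scale_one)
  then show ?thesis by simp
qed

text \<open>Over two elements a new basis vector doubles the span: the result is the disjoint union
  of the old span and its translate.\<close>

lemma card_span:
  assumes "finite B" "independent B"
  shows "finite (span B) \<and> card (span B) = 2 ^ card B"
  using assms
proof (induction B rule: finite_induct)
  case empty
  then show ?case by simp
next
  case (insert a B)
  from insert have ind: "independent B" and a: "a \<notin> span B"
    by (auto simp: independent_insert)
  have eq: "span (insert a B) = span B \<union> (+) a ` span B"
  proof (intro equalityI subsetI)
    fix x assume "x \<in> span (insert a B)"
    then obtain k where k: "x - scale k a \<in> span B" by (auto simp: span_insert)
    show "x \<in> span B \<union> (+) a ` span B"
    proof (cases k)
      case zero
      then show ?thesis using k by simp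
    next
      case one
      then have "x - a \<in> span B" using k by simp
      moreover have "x = a + (x - a)" by simp
      ultimately show ?thesis by blast
    qed
  next
    fix x assume "x \<in> span B \<union> (+) a ` span B"
    then show "x \<in> span (insert a B)"
      by (auto intro: span_add span_base span_mono[THEN subsetD, of B])
  qed
  have "span B \<inter> (+) a ` span B = {}"
  proof -
    have "a \<in> span B" if "x \<in> span B" "a + x \<in> span B" for x
      using span_diff[OF that(2,1)] by simp
    then show ?thesis using a by auto
  qed
  then show ?case
    using insert.IH[OF ind] insert.hyps unfolding eq
    by (simp add: card_Un_disjoint card_image)
qed

lemma card_subspace:
  assumes "finite W" "subspace W"
  shows "card W = 2 ^ dim W"
proof -
  obtain B where B: "B \<subseteq> W" "independent B" "W \<subseteq> span B" "card B = dim W"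
    by (rule basis_exists)
  then have "span B = W" using assms(2) by (simp add: span_minimal subset_antisym)
  then show ?thesis using card_span[of B] B assms(1) finite_subset by metis
qed

end

interpretation chain_bit: bit_vector_space chain_scale ..

interpretation chain_map_bit: bit_vector_space map_scale ..

interpretation chain_pair: vector_space_pair chain_scale chain_scale ..

section \<open>Homomorphisms between subspaces of chains\<close>

lemma homs_0: "f \<in> homs V W \<Longrightarrow> 0 \<in> V \<Longrightarrow> f 0 = 0"
  unfolding homs_def by (metis (mono_tags, lifting) chain.scale_zero_left mem_Collect_eq)

lemma subspace_homs:
  assumes "chain.subspace W"
  shows "chain_map.subspace (homs V W)"
  using assms unfolding chain_map.subspace_def chain.subspace_def homs_def
  by (simp add: map_scale_def chain.scale_right_distrib mult.commute)

lemma linear_on_homs: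
  assumes "Vector_Spaces.linear chain_scale chain_scale g" "chain.subspace V" "g ` V \<subseteq> W"
  shows "(\<lambda>x. if x \<in> V then g x else 0) \<in> homs V W"
proof -
  interpret Vector_Spaces.linear chain_scale chain_scale g by fact
  show ?thesis using assms(2,3)
    by (auto simp: homs_def add scale chain.subspace_def)
qed

text \<open>Restriction to a basis of V identifies the homomorphisms with the arbitrary functions
  from the basis to W. For injectivity it matters that members of \<open>homs\<close> vanish outside
  V.\<close>

lemma card_homs:
  assumes V: "chain.subspace V" "finite V" and W: "chain.subspace W" "finite W"
  shows "finite (homs V W) \<and> card (homs V W) = 2 ^ (chain.dim V * chain.dim W)"
proof -
  obtain B where B: "B \<subseteq> V" "chain.independent B" "V \<subseteq> chain.span B" "card B = chain.dim V"
    by (rule chain.basis_exists)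
  have span: "chain.span B = V" using B V(1) by (simp add: chain.span_minimal subset_antisym)
  have finB: "finite B" using B(1) V(2) finite_subset by blast
  have "bij_betw (\<lambda>f. restrict f B) (homs V W) (B \<rightarrow>\<^sub>E W)"
  proof (rule bij_betw_imageI)
    show "inj_on (\<lambda>f. restrict f B) (homs V W)"
    proof (rule inj_onI, rule ext)
      fix f g x assume f: "f \<in> homs V W" and g: "g \<in> homs V W" and eq: "restrict f B = restrict g B"
      \<comment> \<open>The set where f and g agree is a subspace containing the basis, hence all of
        V.\<close>
      have "chain.subspace {x \<in> V. f x = g x}"
      proof (rule chain.subspaceI)
        show "0 \<in> {x \<in> V. f x = g x}"
          using homs_0[OF f] homs_0[OF g] chain.subspace_0[OF V(1)] by simp
        show "x + y \<in> {x \<in> V. f x = g x}"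
          if "x \<in> {x \<in> V. f x = g x}" "y \<in> {x \<in> V. f x = g x}" for x y
          using that f g chain.subspace_add[OF V(1)] by (simp add: homs_def)
        show "chain_scale c x \<in> {x \<in> V. f x = g x}" if "x \<in> {x \<in> V. f x = g x}" for c x
          using that f g chain.subspace_scale[OF V(1)] by (simp add: homs_def)
      qed
      moreover have "B \<subseteq> {x \<in> V. f x = g x}"
      proof
        fix y assume y: "y \<in> B"
        then have "f y = g y" using fun_cong[OF eq, of y] by simp
        then show "y \<in> {x \<in> V. f x = g x}" using y B(1) by blast
      qed
      ultimately have "V \<subseteq> {x \<in> V. f x = g x}"
        using chain.span_minimal span by blast
      then show "f x = g x" using f g by (cases "x \<in> V") (auto simp: homs_def)
    qed
    show "(\<lambda>f. restrict f B) ` homs V W = B \<rightarrow>\<^sub>E W"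
    proof (intro equalityI subsetI)
      fix r assume "r \<in> (\<lambda>f. restrict f B) ` homs V W"
      then show "r \<in> B \<rightarrow>\<^sub>E W" using B(1) by (auto simp: homs_def)
    next
      fix r assume r: "r \<in> B \<rightarrow>\<^sub>E W"
      obtain g where lin: "Vector_Spaces.linear chain_scale chain_scale g" and g: "\<forall>x\<in>B. g x = r x"
        using chain_pair.linear_independent_extend[OF B(2)] by blast
      have "g ` V = chain.span (g ` B)"
        using chain_pair.linear_span_image[OF lin] span by metis
      also have "\<dots> \<subseteq> W" using W(1) g r by (intro chain.span_minimal) auto
      finally have "(\<lambda>x. if x \<in> V then g x else 0) \<in> homs V W"
        using linear_on_homs[OF lin V(1)] by blast
      moreover have "r = restrict (\<lambda>x. if x \<in> V then g x else 0) B"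
        using r g B(1) by (auto simp: fun_eq_iff PiE_def extensional_def)
      ultimately show "r \<in> (\<lambda>f. restrict f B) ` homs V W" by blast
    qed
  qed
  moreover have "finite (B \<rightarrow>\<^sub>E W)" using finB W(2) by (simp add: finite_PiE)
  moreover have "card (B \<rightarrow>\<^sub>E W) = 2 ^ (chain.dim V * chain.dim W)"
    using finB B(4) chain_bit.card_subspace[OF W(2,1)]
    by (simp add: card_PiE mult.commute flip: power_mult)
  ultimately show ?thesis using bij_betw_finite bij_betw_same_card by metis
qed

lemma homs_of_dim:
  assumes "chain.subspace V" "finite V" "chain.subspace W" "finite W"
  shows "vector_space_of_dim (homs V W) (chain.dim V * chain.dim W)"
proof -
  have "finite (homs V W)" "card (homs V W) = 2 ^ (chain.dim V * chain.dim W)"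
    using card_homs[OF assms] by auto
  moreover have "chain_map.subspace (homs V W)" using subspace_homs assms(3) .
  ultimately show ?thesis
    using chain_map_bit.card_subspace[of "homs V W"] by (simp add: vector_space_of_dim_def)
qed

section \<open>The complex of faces with injective labels\<close>

definition faces :: "'p set \<Rightarrow> ('p \<Rightarrow> 'l) \<Rightarrow> 'p set set" where
  "faces F l = {B. B \<subseteq> F \<and> inj_on l B}"

text \<open>Grouped by the size k of K: there are \<open>card D choose k\<close> such K, and each
  leaves \<open>card U + k\<close> elements from which C is chosen. The pairs (K, C) are the codes
  of faces in \<open>card_faces\<close>.\<close>

lemma card_Sigma_subsets:
  assumes "finite D" "finite U" "U \<inter> D = {}"
  shows "card (SIGMA K:Pow D. {C. C \<subseteq> U \<union> K \<and> card C = n}) =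
    (\<Sum>k\<le>card D. (card D choose k) * ((card U + k) choose n))"
proof -
  have "card (SIGMA K:Pow D. {C. C \<subseteq> U \<union> K \<and> card C = n}) =
      (\<Sum>K\<in>Pow D. card {C. C \<subseteq> U \<union> K \<and> card C = n})"
    using assms by (intro card_SigmaI) (auto intro: finite_subset[of _ "Pow (U \<union> D)"])
  also have "\<dots> = (\<Sum>K\<in>Pow D. (card U + card K) choose n)"
  proof (rule sum.cong[OF refl])
    fix K assume "K \<in> Pow D"
    then have "finite (U \<union> K)" "card (U \<union> K) = card U + card K"
      using assms by (auto intro: finite_subset card_Un_disjoint)
    then show "card {C. C \<subseteq> U \<union> K \<and> card C = n} = (card U + card K) choose n"
      by (simp add: n_subsets)
  qed
  also have "\<dots> = (\<Sum>k\<in>{..card D}. \<Sum>K\<in>{K \<in> Pow D. card K = k}. (card U + card K) choose n)"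
    using assms by (intro sum.group[symmetric]) (auto intro: card_mono)
  also have "\<dots> = (\<Sum>k\<le>card D. (card D choose k) * ((card U + k) choose n))"
    using assms(1) by (intro sum.cong) (auto simp: n_subsets[of D])
  finally show ?thesis .
qed

text \<open>A face is encoded by the set \<open>C\<close> of the labels it misses and the set \<open>K\<close> of those labels
  with two vertices whose first vertex it misses.\<close>

lemma card_faces:
  assumes F: "finite F" "l ` F = U \<union> D" "U \<inter> D = {}"
    and U: "\<And>P. P \<in> U \<Longrightarrow> \<exists>x. {x \<in> F. l x = P} = {x}"
    and D: "\<And>P. P \<in> D \<Longrightarrow> card {x \<in> F. l x = P} = 2"
  shows "card {B \<in> faces F l. card B + n = card (l ` F)} =
    (\<Sum>k\<le>card D. (card D choose k) * ((card U + k) choose n))"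
proof -
  \<comment> \<open>The vertices over each label get two names, which coincide for labels in U, so
    that both kinds of labels are decoded alike.\<close>
  have "\<exists>xy. {z \<in> F. l z = P} = {fst xy, snd xy} \<and> (P \<in> U \<longrightarrow> fst xy = snd xy) \<and>
      (P \<in> D \<longrightarrow> fst xy \<noteq> snd xy)" if "P \<in> U \<union> D" for P
  proof (cases "P \<in> U")
    case True
    then show ?thesis using U[of P] F(3) by (metis disjoint_iff fst_conv insert_absorb2 snd_conv)
  next
    case False
    then show ?thesis using D[of P] that by (metis UnE card_2_iff fst_conv snd_conv)
  qed
  then have "\<forall>P\<in>U \<union> D. \<exists>xy. {z \<in> F. l z = P} = {fst xy, snd xy} \<and>
      (P \<in> U \<longrightarrow> fst xy = snd xy) \<and> (P \<in> D \<longrightarrow> fst xy \<noteq> snd xy)"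
    by blast
  from bchoice[OF this] obtain f where f: "\<forall>P\<in>U \<union> D. {z \<in> F. l z = P} = {fst (f P), snd (f P)} \<and>
      (P \<in> U \<longrightarrow> fst (f P) = snd (f P)) \<and> (P \<in> D \<longrightarrow> fst (f P) \<noteq> snd (f P))"
    by blast
  define a b where "a P = fst (f P)" and "b P = snd (f P)" for P
  have ab: "{z \<in> F. l z = P} = {a P, b P}" if "P \<in> U \<union> D" for P
    using f that by (simp add: a_def b_def)
  have abU: "a P = b P" if "P \<in> U" for P using f that by (simp add: a_def b_def)
  have abD: "a P \<noteq> b P" if "P \<in> D" for P using f that by (simp add: a_def b_def)
  have a: "a P \<in> F" "l (a P) = P" and b: "b P \<in> F" "l (b P) = P" if "P \<in> U \<union> D" for P
    using ab[OF that] by auto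
  have cases: "x = a (l x) \<or> x = b (l x)" and lx: "l x \<in> U \<union> D" if "x \<in> F" for x
    using ab[of "l x"] F(2) that by auto
  have fin: "finite U" "finite D" using F(1,2) by (metis finite_Un finite_imageI)+
  let ?R = "U \<union> D"
  let ?S = "SIGMA K:Pow D. {C. C \<subseteq> U \<union> K \<and> card C = n}"
  let ?T = "{B \<in> faces F l. card B + n = card (l ` F)}"
  \<comment> \<open>\<open>G\<close> decodes: a label outside C gets its second vertex if it lies in
    K and its first vertex otherwise. The condition that C lies in U \<union> K reflects that
    missing a label of D includes missing its first vertex.\<close>
  define G where "G = (\<lambda>(K, C). a ` (?R - C - K) \<union> b ` (K - C))"
  define H where "H = (\<lambda>B. ({P \<in> D. a P \<notin> B}, ?R - l ` B))"
  have lG: "l ` G (K, C) = ?R - C" and injG: "inj_on l (G (K, C))" and GF: "G (K, C) \<subseteq> F"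
    if "(K, C) \<in> ?S" for K C
  proof -
    have K: "K \<subseteq> D" using that by auto
    have "l ` a ` (?R - C - K) = ?R - C - K" "l ` b ` (K - C) = K - C"
      using a b K by (force simp: image_image)+
    then show "l ` G (K, C) = ?R - C" using K by (auto simp: G_def image_Un)
    have "x = (if l x \<in> K then b (l x) else a (l x))" if "x \<in> G (K, C)" for x
      using that a b subsetD[OF K] by (auto simp: G_def)
    then show "inj_on l (G (K, C))" by (metis inj_onI)
    show "G (K, C) \<subseteq> F" using a b K by (auto simp: G_def)
  qed
  have "bij_betw G ?S ?T"
  proof (rule bij_betw_byWitness[where f' = H])
    show "\<forall>KC\<in>?S. H (G KC) = KC"
    proof clarify
      fix K C assume KC: "K \<subseteq> D" "C \<subseteq> U \<union> K" "n = card C"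
      then have S: "(K, C) \<in> ?S" by auto
      have "a P \<in> G (K, C) \<longleftrightarrow> P \<notin> K" if "P \<in> D" for P
      proof
        show "P \<notin> K" if "a P \<in> G (K, C)"
          using that a b abD \<open>P \<in> D\<close> KC(1) unfolding G_def by (auto; metis UnCI subsetD)
        show "a P \<in> G (K, C)" if "P \<notin> K"
          using that KC(2) \<open>P \<in> D\<close> F(3) unfolding G_def by auto
      qed
      then have "{P \<in> D. a P \<notin> G (K, C)} = K" using KC(1) by auto
      moreover have "?R - l ` G (K, C) = C" using lG[OF S] KC by auto
      ultimately show "H (G (K, C)) = (K, C)" by (simp add: H_def)
    qed
    show "\<forall>B\<in>?T. G (H B) = B"
    proof
      fix B assume "B \<in> ?T"
      then have BF: "B \<subseteq> F" and inj: "inj_on l B" by (auto simp: faces_def)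
      show "G (H B) = B"
      proof (intro equalityI subsetI)
        fix x assume "x \<in> G (H B)"
        then obtain P where P: "P \<in> ?R" "P \<in> l ` B"
          and x: "x = a P \<and> (P \<in> U \<or> a P \<in> B) \<or> x = b P \<and> P \<in> D \<and> a P \<notin> B"
          unfolding G_def H_def by auto
        obtain y where "y \<in> B" "l y = P" using P by auto
        then have "y \<in> B \<and> (y = a P \<or> y = b P)" using cases[of y] BF by auto
        then show "x \<in> B" using x abU by auto
      next
        fix x assume x: "x \<in> B"
        let ?P = "l x"
        have P: "?P \<in> ?R" and xF: "x \<in> F" using lx x BF by auto
        show "x \<in> G (H B)"
        proof (cases "x = a ?P")
          case True
          then have "?P \<in> ?R - (?R - l ` B) - {P \<in> D. a P \<notin> B}" using x P by auto
          then show ?thesis using True unfolding G_def H_def by auto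
        next
          case False
          then have xb: "x = b ?P" using cases xF by auto
          then have "?P \<in> D" using False abU[of ?P] P by auto
          moreover have "a ?P \<notin> B" using inj x a[OF P] False by (auto dest: inj_onD)
          ultimately have "?P \<in> {P \<in> D. a P \<notin> B} - (?R - l ` B)" using x by auto
          then show ?thesis using xb unfolding G_def H_def by auto
        qed
      qed
    qed
    show "G ` ?S \<subseteq> ?T"
    proof clarify
      fix K C assume KC: "K \<subseteq> D" "C \<subseteq> U \<union> K" "n = card C"
      then have S: "(K, C) \<in> ?S" by auto
      have "card (G (K, C)) = card (?R - C)" using lG[OF S] injG[OF S] by (metis card_image)
      moreover have "card (?R - C) + card C = card ?R"
      proof -
        have "C \<subseteq> ?R" using KC by auto
        then show ?thesis using fin
          by (metis card_Diff_subset card_mono finite_Un finite_subset le_add_diff_inverse2)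
      qed
      ultimately show "G (K, C) \<in> faces F l \<and> card (G (K, C)) + card C = card (l ` F)"
        using injG[OF S] GF[OF S] F(2) by (simp add: faces_def)
    qed
    show "H ` ?T \<subseteq> ?S"
    proof
      fix y assume "y \<in> H ` ?T"
      then obtain B where B: "B \<in> ?T" and y: "y = H B" by auto
      then have BF: "B \<subseteq> F" and inj: "inj_on l B" by (auto simp: faces_def)
      have "l ` B \<subseteq> ?R" using BF lx by auto
      then have "card (?R - l ` B) + card B = card ?R" using fin card_image[OF inj]
        by (metis card_Diff_subset card_mono finite_Un finite_subset le_add_diff_inverse2)
      then have "card (?R - l ` B) = n" using B F(2) by simp
      moreover have "?R - l ` B \<subseteq> U \<union> {P \<in> D. a P \<notin> B}" using a by force
      ultimately show "y \<in> ?S" using y by (auto simp: H_def)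
    qed
  qed
  from bij_betw_same_card[OF this] card_Sigma_subsets[OF fin(2,1) F(3)] show ?thesis
    by (rule trans[OF sym])
qed

section \<open>The coboundary complex of the faces\<close>

lemma (in bit_vector_space) sum_symmetric_eq_0:
  fixes f :: "'c \<Rightarrow> 'c \<Rightarrow> 'b"
  assumes "finite S" "\<And>x y. f x y = f y x" "\<And>x. f x x = 0"
  shows "(\<Sum>x\<in>S. \<Sum>y\<in>S. f x y) = 0"
  using assms(1)
proof (induction S rule: finite_induct)
  case empty
  then show ?case by simp
next
  case (insert a S)
  have "(\<Sum>x\<in>insert a S. \<Sum>y\<in>insert a S. f x y) =
      (\<Sum>y\<in>S. f a y) + (\<Sum>x\<in>S. f x a) + (\<Sum>x\<in>S. \<Sum>y\<in>S. f x y)"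
    using insert.hyps assms(3) by (simp add: sum.distrib algebra_simps)
  \<comment> \<open>The row and the column of \<open>a\<close> agree, so they cancel in
    characteristic 2.\<close>
  also have "(\<Sum>x\<in>S. f x a) = (\<Sum>y\<in>S. f a y)" using assms(2) by (intro sum.cong) auto
  finally show ?case using insert.IH by (simp add: add_self)
qed

text \<open>Here \<open>e\<close> names abstract basis vectors. The instance of interest is
  \<open>face_complex_E\<close>, where the vertices of a face are the places at which strands
  break.\<close>

locale face_complex =
  fixes F :: "'p set" and l :: "'p \<Rightarrow> 'l" and e :: "'p set \<Rightarrow> chain" and d :: "chain \<Rightarrow> chain"
  assumes finite_F: "finite F"
    and linear_d: "Vector_Spaces.linear chain_scale chain_scale d"
    and inj_e: "inj_on e (faces F l)"
    and independent_e: "chain.independent (e ` faces F l)"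
    and d_e: "B \<in> faces F l \<Longrightarrow> d (e B) = (\<Sum>x\<in>{x \<in> F. l x \<notin> l ` B}. e (insert x B))"
begin

sublocale d: Vector_Spaces.linear chain_scale chain_scale d
  by (rule linear_d)

lemma finite_faces: "finite (faces F l)"
  unfolding faces_def using finite_F by (auto intro: finite_subset[of _ "Pow F"])

lemma insert_faces: "B \<in> faces F l \<Longrightarrow> x \<in> F \<Longrightarrow> l x \<notin> l ` B \<Longrightarrow> insert x B \<in> faces F l"
  by (auto simp: faces_def)

lemma remove_faces: "B \<in> faces F l \<Longrightarrow> B - {x} \<in> faces F l"
  by (auto simp: faces_def inj_on_diff)

text \<open>The number n of missing labels, fixed by a sum to avoid truncated subtraction. Adding a
  vertex lowers it by one.\<close>

definition grade :: "nat \<Rightarrow> 'p set set" where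
  "grade n = {B \<in> faces F l. card B + n = card (l ` F)}"

definition A :: "nat \<Rightarrow> chain set" where
  "A n = chain.span (e ` grade n)"

definition cycles :: "nat \<Rightarrow> chain set" where
  "cycles n = {x \<in> A n. d x = 0}"

lemma finite_face: "B \<in> faces F l \<Longrightarrow> finite B"
  using finite_F by (auto simp: faces_def intro: finite_subset)

lemma grade_faces: "grade n \<subseteq> faces F l"
  by (auto simp: grade_def)

lemma card_A: "finite (A n) \<and> card (A n) = 2 ^ card (grade n)"
proof -
  have "finite (e ` grade n)" using finite_faces grade_faces by (metis finite_imageI finite_subset)
  moreover have "chain.independent (e ` grade n)"
    using independent_e grade_faces by (metis chain.independent_mono image_mono)
  moreover have "card (e ` grade n) = card (grade n)"
    using inj_e grade_faces by (metis card_image inj_on_subset)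
  ultimately show ?thesis using chain_bit.card_span[of "e ` grade n"] by (simp add: A_def)
qed

lemma subspace_A: "chain.subspace (A n)"
  by (simp add: A_def)

lemma subspace_cycles: "chain.subspace (cycles n)"
  using subspace_A[of n] by (auto simp: cycles_def chain.subspace_def d.add d.scale)

lemma finite_cycles: "finite (cycles n)"
  using card_A[of n] by (simp add: cycles_def)

lemma A_subset: "A n \<subseteq> chain.span (e ` faces F l)"
  unfolding A_def using grade_faces by (intro chain.span_mono image_mono)

text \<open>A face of grade 0 carries every label, so no vertex can be added to it.\<close>

lemma cycles_0: "cycles 0 = A 0"
proof -
  have "d x = 0" if "x \<in> A 0" for x
    using that unfolding A_def
  proof (rule chain.span_induct)
    show "chain.subspace {x. d x = 0}" by (auto simp: chain.subspace_def d.add d.scale)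
    fix x assume "x \<in> e ` grade 0"
    then obtain B where B: "B \<in> faces F l" "card B = card (l ` F)" and x: "x = e B"
      by (auto simp: grade_def)
    then have "l ` B \<subseteq> l ` F" "card (l ` B) = card (l ` F)" by (auto simp: faces_def card_image)
    then have "l ` B = l ` F" using finite_F by (simp add: card_subset_eq)
    then have "{x \<in> F. l x \<notin> l ` B} = {}" by auto
    then show "d x = 0" using d_e[OF B(1)] x by (simp only: sum.empty)
  qed
  then show ?thesis by (auto simp: cycles_def)
qed

lemma d_A: "x \<in> A (Suc n) \<Longrightarrow> d x \<in> A n"
  unfolding A_def[of "Suc n"]
proof (erule chain.span_induct)
  show "chain.subspace {x. d x \<in> A n}"
    using subspace_A[of n] by (auto simp: chain.subspace_def d.add d.scale)
  fix x assume "x \<in> e ` grade (Suc n)"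
  then obtain B where B: "B \<in> faces F l" "card B + Suc n = card (l ` F)" and x: "x = e B"
    by (auto simp: grade_def)
  have "e (insert y B) \<in> A n" if "y \<in> F" "l y \<notin> l ` B" for y
  proof -
    have "y \<notin> B" using that by auto
    then have "insert y B \<in> grade n"
      using B insert_faces[OF B(1) that] finite_face by (simp add: grade_def)
    then show ?thesis by (simp add: A_def chain.span_base)
  qed
  then show "d x \<in> A n" using d_e[OF B(1)] x by (auto intro: chain.subspace_sum[OF subspace_A])
qed

text \<open>Adding x and then y gives the same face as adding y and then x, so the terms cancel in
  pairs.\<close>

lemma d_d: "x \<in> chain.span (e ` faces F l) \<Longrightarrow> d (d x) = 0"
proof (erule chain.span_induct)
  show "chain.subspace {x. d (d x) = 0}"
    by (rule chain.subspaceI) (simp_all add: d.add d.scale)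
  fix x assume "x \<in> e ` faces F l"
  then obtain B where B: "B \<in> faces F l" and x: "x = e B" by auto
  let ?S = "{x \<in> F. l x \<notin> l ` B}"
  have fin: "finite ?S" using finite_F by simp
  \<comment> \<open>Once x has been added, no vertex with its label may follow. Putting 0 for such y
    lets both sums run over the same set and makes the summand symmetric with zero diagonal.\<close>
  have "d (e (insert x B)) = (\<Sum>y\<in>?S. if l x = l y then 0 else e (insert y (insert x B)))"
    if "x \<in> ?S" for x
  proof -
    have "d (e (insert x B)) = (\<Sum>y\<in>{y \<in> ?S. \<not> l x = l y}. e (insert y (insert x B)))"
      using that insert_faces[OF B] by (subst d_e) (auto intro!: sum.cong)
    also have "\<dots> = (\<Sum>y\<in>?S. if \<not> l x = l y then e (insert y (insert x B)) else 0)"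
      by (rule sum.inter_filter[OF fin])
    also have "\<dots> = (\<Sum>y\<in>?S. if l x = l y then 0 else e (insert y (insert x B)))"
      by (intro sum.cong) auto
    finally show ?thesis .
  qed
  then have "d (d x) = (\<Sum>x\<in>?S. \<Sum>y\<in>?S. if l x = l y then 0 else e (insert y (insert x B)))"
    using d_e[OF B] x by (simp add: d.sum)
  also have "\<dots> = 0"
    by (rule chain_bit.sum_symmetric_eq_0[OF fin]) (auto simp: insert_commute)
  finally show "d (d x) = 0" .
qed

end

text \<open>Removing a vertex \<open>p\<close> that is alone with its label is a contracting homotopy.\<close>

locale contractible_face_complex = face_complex +
  fixes p
  assumes p: "p \<in> F" "\<And>x. x \<in> F \<Longrightarrow> l x = l p \<Longrightarrow> x = p"
begin

lemma contraction:
  "\<exists>g. Vector_Spaces.linear chain_scale chain_scale g \<and>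
     (\<forall>B\<in>faces F l. g (e B) = (if p \<in> B then e (B - {p}) else 0))"
proof -
  define r where "r v = (let B = inv_into (faces F l) e v in if p \<in> B then e (B - {p}) else 0)" for v
  from chain_pair.linear_independent_extend[OF independent_e, of r]
  obtain g where "Vector_Spaces.linear chain_scale chain_scale g \<and> (\<forall>x\<in>e ` faces F l. g x = r x)" ..
  then have lin: "Vector_Spaces.linear chain_scale chain_scale g"
    and g: "\<And>B. B \<in> faces F l \<Longrightarrow> g (e B) = r (e B)"
    by auto
  then have "g (e B) = (if p \<in> B then e (B - {p}) else 0)" if "B \<in> faces F l" for B
    using g[OF that] inj_e that by (simp add: r_def)
  with lin show ?thesis by blast
qed

text \<open>Let g remove p. If p is not in B, only the term of d that adds p survives g, and it
  gives back B. If p is in B, then d(g(e B)) has the term e B that restores p, and its other terms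
  are exactly those of g(d(e B)).\<close>

lemma homotopy:
  "\<exists>g. Vector_Spaces.linear chain_scale chain_scale g \<and>
     (\<forall>x\<in>chain.span (e ` faces F l). d (g x) + g (d x) = x) \<and>
     (\<forall>n. \<forall>x\<in>A n. g x \<in> A (Suc n))"
proof -
  from contraction obtain g where "Vector_Spaces.linear chain_scale chain_scale g \<and>
    (\<forall>B\<in>faces F l. g (e B) = (if p \<in> B then e (B - {p}) else 0))" ..
  then have lin: "Vector_Spaces.linear chain_scale chain_scale g"
    and g: "\<And>B. B \<in> faces F l \<Longrightarrow> g (e B) = (if p \<in> B then e (B - {p}) else 0)"
    by simp_all
  interpret g: Vector_Spaces.linear chain_scale chain_scale g by fact
  have homotopy: "d (g x) + g (d x) = x" if "x \<in> chain.span (e ` faces F l)" for x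
    using that
  proof (rule chain.span_induct)
    show "chain.subspace {x. d (g x) + g (d x) = x}"
    proof (rule chain.subspaceI; simp only: mem_Collect_eq)
      show "d (g 0) + g (d 0) = 0" by (simp add: d.zero g.zero)
      fix c x y assume x: "d (g x) + g (d x) = x"
      have "d (g (chain_scale c x)) + g (d (chain_scale c x)) = chain_scale c (d (g x) + g (d x))"
        by (simp only: d.scale g.scale chain.scale_right_distrib)
      then show "d (g (chain_scale c x)) + g (d (chain_scale c x)) = chain_scale c x"
        by (simp only: x)
      assume y: "d (g y) + g (d y) = y"
      have "d (g (x + y)) + g (d (x + y)) = (d (g x) + g (d x)) + (d (g y) + g (d y))"
        by (simp only: d.add g.add ac_simps)
      then show "d (g (x + y)) + g (d (x + y)) = x + y" by (simp only: x y)
    qed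
    fix x assume "x \<in> e ` faces F l"
    then obtain B where B: "B \<in> faces F l" and x: "x = e B" by auto
    let ?S = "\<lambda>B. {x \<in> F. l x \<notin> l ` B}"
    have fin: "finite (?S B)" for B using finite_F by simp
    have gd: "g (d x) = (\<Sum>y\<in>?S B. if p \<in> insert y B then e (insert y B - {p}) else 0)"
    proof -
      have "g (d x) = (\<Sum>y\<in>?S B. g (e (insert y B)))" by (simp only: x d_e[OF B] g.sum)
      also have "\<dots> = (\<Sum>y\<in>?S B. if p \<in> insert y B then e (insert y B - {p}) else 0)"
        by (rule sum.cong[OF refl], rule g, rule insert_faces[OF B]) auto
      finally show ?thesis .
    qed
    show "d (g x) + g (d x) = x"
    proof (cases "p \<in> B")
      case False
      have "l p \<notin> l ` B"
      proof
        assume "l p \<in> l ` B"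
        then obtain y where y: "y \<in> B" "l y = l p" by auto
        then have "y = p" using B by (intro p(2)) (auto simp: faces_def)
        then show False using y False by simp
      qed
      then have pS: "p \<in> ?S B" using p(1) by simp
      have "g (d x) = (\<Sum>y\<in>?S B. if y = p then e B else 0)"
        unfolding gd using False by (intro sum.cong) auto
      also have "\<dots> = e B" using pS fin by (simp add: sum.delta)
      finally show ?thesis using g[OF B] False x by (simp add: d.zero)
    next
      case True
      \<comment> \<open>No other vertex shares the label of p, so removing p makes only p available
        again.\<close>
      have SB: "?S (B - {p}) = insert p (?S B)"
      proof (intro equalityI subsetI)
        fix y assume y: "y \<in> ?S (B - {p})"
        have "y = p" if "l y \<in> l ` B"
        proof (rule p(2))
          show "l y = l p" using y that by auto
        qed (use y in simp)
        then show "y \<in> insert p (?S B)" using y by auto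
      next
        fix y assume y: "y \<in> insert p (?S B)"
        have "l p \<notin> l ` (B - {p})"
          using True B by (auto simp: faces_def dest: inj_onD)
        then show "y \<in> ?S (B - {p})" using y p(1) by auto
      qed
      have "d (g x) = (\<Sum>y\<in>insert p (?S B). e (insert y (B - {p})))"
        using g[OF B] True x d_e[OF remove_faces[OF B]] SB by simp
      also have "\<dots> = e B + (\<Sum>y\<in>?S B. e (insert y (B - {p})))"
        using True fin by (subst sum.insert) (auto simp: insert_absorb)
      also have "(\<Sum>y\<in>?S B. e (insert y (B - {p}))) = g (d x)"
        unfolding gd using True by (intro sum.cong refl) (auto simp: insert_Diff_if)
      finally show ?thesis by (simp only: x add.assoc chain_bit.add_self add_0_right)
    qed
  qed
  have grade: "g x \<in> A (Suc n)" if "x \<in> A n" for x n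
    using that unfolding A_def[of n]
  proof (rule chain.span_induct)
    show "chain.subspace {x. g x \<in> A (Suc n)}"
      using subspace_A[of "Suc n"] by (auto simp: chain.subspace_def g.add g.scale)
    fix x assume "x \<in> e ` grade n"
    then obtain B where B: "B \<in> faces F l" "card B + n = card (l ` F)" and x: "x = e B"
      by (auto simp: grade_def)
    show "g x \<in> A (Suc n)"
    proof (cases "p \<in> B")
      case False
      then show ?thesis using g[OF B(1)] x subspace_A by (simp add: chain.subspace_0)
    next
      case True
      then have "card B = Suc (card (B - {p}))" using finite_face[OF B(1)] by (metis card.remove)
      then have "B - {p} \<in> grade (Suc n)" using B remove_faces by (simp add: grade_def)
      then show ?thesis using g[OF B(1)] x True by (simp add: A_def chain.span_base)
    qed
  qed
  with lin homotopy show ?thesis by blast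
qed

text \<open>The homotopy splits the complex: x is the sum of the cycle x + g(d x) and the lift g(d
  x) of the cycle d x.\<close>

lemma card_A_Suc: "card (A (Suc n)) = card (cycles (Suc n)) * card (cycles n)"
proof -
  from homotopy obtain g where "Vector_Spaces.linear chain_scale chain_scale g \<and>
    (\<forall>x\<in>chain.span (e ` faces F l). d (g x) + g (d x) = x) \<and>
    (\<forall>n. \<forall>x\<in>A n. g x \<in> A (Suc n))" ..
  then have lin: "Vector_Spaces.linear chain_scale chain_scale g"
    and dg: "\<And>x. x \<in> chain.span (e ` faces F l) \<Longrightarrow> d (g x) + g (d x) = x"
    and gA: "\<And>n x. x \<in> A n \<Longrightarrow> g x \<in> A (Suc n)"
    by simp_all
  interpret g: Vector_Spaces.linear chain_scale chain_scale g by fact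
  have dgc: "d (g x) = x" if "x \<in> cycles n" for x
    using dg[of x] that A_subset[of n] by (auto simp: cycles_def g.zero)
  have "bij_betw (\<lambda>(a, b). a + g b) (cycles (Suc n) \<times> cycles n) (A (Suc n))"
  proof (rule bij_betw_byWitness[where f' = "\<lambda>x. (x + g (d x), d x)"])
    show "\<forall>ab\<in>cycles (Suc n) \<times> cycles n.
        (\<lambda>x. (x + g (d x), d x)) ((\<lambda>(a, b). a + g b) ab) = ab"
    proof
      fix ab assume "ab \<in> cycles (Suc n) \<times> cycles n"
      then obtain a b where ab: "ab = (a, b)" "d a = 0" "b \<in> cycles n" by (auto simp: cycles_def)
      have "d (a + g b) = b" by (simp only: d.add ab(2) dgc[OF ab(3)] add_0_left)
      then show "(\<lambda>x. (x + g (d x), d x)) ((\<lambda>(a, b). a + g b) ab) = ab"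
        by (simp only: ab(1) prod.case add.assoc chain_bit.add_self add_0_right)
    qed
    show "\<forall>x\<in>A (Suc n). (\<lambda>(a, b). a + g b) (x + g (d x), d x) = x"
      by (intro ballI, simp only: prod.case add.assoc chain_bit.add_self add_0_right)
    show "(\<lambda>(a, b). a + g b) ` (cycles (Suc n) \<times> cycles n) \<subseteq> A (Suc n)"
      using subspace_A[of "Suc n"] gA by (auto simp: cycles_def chain.subspace_def)
    show "(\<lambda>x. (x + g (d x), d x)) ` A (Suc n) \<subseteq> cycles (Suc n) \<times> cycles n"
    proof clarify
      fix x assume x: "x \<in> A (Suc n)"
      then have dx: "d x \<in> cycles n" using d_A d_d subsetD[OF A_subset] by (auto simp: cycles_def)
      moreover have "x + g (d x) \<in> A (Suc n)"
        using x dx gA subspace_A by (auto simp: cycles_def intro: chain.subspace_add)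
      moreover have "d (x + g (d x)) = 0" using dgc[OF dx] by (simp only: d.add chain_bit.add_self)
      ultimately show "x + g (d x) \<in> cycles (Suc n) \<and> d x \<in> cycles n"
        by (simp add: cycles_def)
    qed
  qed
  then show ?thesis by (metis bij_betw_same_card card_cartesian_product)
qed

text \<open>By \<open>card_A_Suc\<close> the dimension of \<open>A (Suc n)\<close> is the sum of two
  consecutive cycle dimensions. Pascal's rule shows that the stated sums satisfy the same recursion,
  and \<open>A 0\<close> consists of cycles.\<close>

lemma dim_cycles:
  assumes lF: "l ` F = U \<union> D" "U \<inter> D = {}" and pU: "l p \<in> U"
    and U: "\<And>P. P \<in> U \<Longrightarrow> \<exists>x. {x \<in> F. l x = P} = {x}"
    and D: "\<And>P. P \<in> D \<Longrightarrow> card {x \<in> F. l x = P} = 2"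
  shows "chain.dim (cycles n) = (\<Sum>k\<le>card D. (card D choose k) * ((card U + k - 1) choose n))"
    (is "_ = ?z n")
proof -
  have a: "card (grade n) = (\<Sum>k\<le>card D. (card D choose k) * ((card U + k) choose n))" for n
    using card_faces[OF finite_F lF U D] by (simp add: grade_def)
  have "finite U" using finite_F lF(1) by (metis finite_Un finite_imageI)
  \<comment> \<open>As U contains the label of p, \<open>card U + k - 1\<close> is M + k without
    truncation, and Pascal's rule applies.\<close>
  then obtain M where M: "card U = Suc M" using pU by (metis card_gt_0_iff empty_iff gr0_implies_Suc)
  have a_Suc: "card (grade (Suc n)) = ?z (Suc n) + ?z n" for n
    unfolding a M by (simp add: sum.distrib algebra_simps)
  have "card (cycles n) = 2 ^ ?z n"
  proof (induction n)
    case 0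
    show ?case using cycles_0 card_A[of 0] by (simp add: a)
  next
    case (Suc n)
    have "card (cycles (Suc n)) * 2 ^ ?z n = 2 ^ ?z (Suc n) * 2 ^ ?z n"
      using card_A_Suc[of n] card_A[of "Suc n"] Suc.IH a_Suc[of n] by (simp add: power_add)
    then show ?case by simp
  qed
  then show ?thesis using chain_bit.card_subspace[OF finite_cycles subspace_cycles, of n] by simp
qed

lemma inverting_maps_of_dim:
  "affine_space_of_dim {f \<in> homs (cycles n) (A (Suc n)). \<forall>x\<in>cycles n. x = d (f x)}
     (chain.dim (cycles n) * chain.dim (cycles (Suc n)))"
proof -
  from homotopy obtain g where "Vector_Spaces.linear chain_scale chain_scale g \<and>
    (\<forall>x\<in>chain.span (e ` faces F l). d (g x) + g (d x) = x) \<and>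
    (\<forall>n. \<forall>x\<in>A n. g x \<in> A (Suc n))" ..
  then have lin: "Vector_Spaces.linear chain_scale chain_scale g"
    and dg: "\<And>x. x \<in> chain.span (e ` faces F l) \<Longrightarrow> d (g x) + g (d x) = x"
    and gA: "\<And>n x. x \<in> A n \<Longrightarrow> g x \<in> A (Suc n)"
    by simp_all
  interpret g: Vector_Spaces.linear chain_scale chain_scale g by fact
  have dgc: "d (g x) = x" if "x \<in> cycles n" for x
    using dg[of x] that A_subset[of n] by (auto simp: cycles_def g.zero)
  \<comment> \<open>The homotopy inverts d on cycles, where its summand g(d x) vanishes. It serves
    as the base point of the affine space.\<close>
  let ?f = "\<lambda>x. if x \<in> cycles n then g x else 0"
  have f: "?f \<in> homs (cycles n) (A (Suc n))"
    using linear_on_homs[OF lin subspace_cycles] gA by (simp add: cycles_def image_subset_iff)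
  have A: "chain_map.subspace (homs (cycles n) (A (Suc n)))"
    using subspace_homs subspace_A .
  have "{f \<in> homs (cycles n) (A (Suc n)). \<forall>x\<in>cycles n. x = d (f x)} =
      (\<lambda>g. ?f + g) ` homs (cycles n) (cycles (Suc n))"
  proof (intro equalityI subsetI)
    fix k assume k: "k \<in> {f \<in> homs (cycles n) (A (Suc n)). \<forall>x\<in>cycles n. x = d (f x)}"
    \<comment> \<open>In characteristic 2 this sum is the difference of two solutions.\<close>
    have "?f + k \<in> homs (cycles n) (A (Suc n))"
      using chain_map.subspace_add[OF A f] k by blast
    moreover have "d ((?f + k) x) = 0" if "x \<in> cycles n" for x
      using that k dgc chain_bit.add_self by (simp add: d.add)
    ultimately have "?f + k \<in> homs (cycles n) (cycles (Suc n))"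
      by (simp add: homs_def cycles_def[of "Suc n"])
    moreover have "k = ?f + (?f + k)"
      by (simp only: add.assoc[symmetric] chain_map_bit.add_self add_0_left)
    ultimately show "k \<in> (\<lambda>g. ?f + g) ` homs (cycles n) (cycles (Suc n))" by blast
  next
    fix k assume "k \<in> (\<lambda>g. ?f + g) ` homs (cycles n) (cycles (Suc n))"
    then obtain m where m: "m \<in> homs (cycles n) (cycles (Suc n))" and k: "k = ?f + m" by auto
    have "m \<in> homs (cycles n) (A (Suc n))" using m by (auto simp: homs_def cycles_def)
    then have "k \<in> homs (cycles n) (A (Suc n))" unfolding k by (rule chain_map.subspace_add[OF A f])
    moreover have "x = d (k x)" if "x \<in> cycles n" for x
      using that m dgc by (auto simp: k d.add homs_def cycles_def[of "Suc n"])
    ultimately show "k \<in> {f \<in> homs (cycles n) (A (Suc n)). \<forall>x\<in>cycles n. x = d (f x)}" by blast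
  qed
  then show ?thesis
    unfolding affine_space_of_dim_def
    using homs_of_dim[OF subspace_cycles finite_cycles subspace_cycles finite_cycles] by metis
qed

end

section \<open>Moving strands of a viable class\<close>

lemma finite_points: "finite (points Z)"
proof -
  have "points Z = (SIGMA i:{1..num_intervals Z}. {..num_places Z i + 1})"
    by (auto simp: points_def)
  then show ?thesis by simp
qed

lemma finite_places: "finite (places Z)"
  by (rule finite_subset[OF _ finite_points]) (auto simp: places_def points_def)

lemma places_points: "p \<in> places Z \<Longrightarrow> p \<in> points Z"
  by (auto simp: places_def points_def)

text \<open>The support of \<open>segment_class\<close>. As a step is named by its left end,
  \<open>covers x y p\<close> for a point p speaks of the step leaving p.\<close>

definition covers :: "point \<Rightarrow> point \<Rightarrow> nat \<times> nat \<Rightarrow> bool" where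
  "covers x y e \<longleftrightarrow> fst e = fst x \<and> fst e = fst y \<and> snd x \<le> snd e \<and> snd e < snd y"

text \<open>The points that some strand passes over; a horizontal strand placed there crosses it.
  For a viable class this set determines the strands (\<open>strands_eqI\<close>).\<close>

definition inside :: "strands \<Rightarrow> point set" where
  "inside \<mu> = {p. \<exists>x y. (x, y) \<in> \<mu> \<and> point_less x p \<and> point_less p y}"

text \<open>Cuts a strand passing over p in two, which is how its crossing with a horizontal strand
  at p is resolved. For a viable class \<open>join_at\<close> undoes it
  (\<open>join_at_break_at\<close>).\<close>

definition break_at :: "point \<Rightarrow> strands \<Rightarrow> strands" where
  "break_at p \<mu> = {(x, y) \<in> \<mu>. \<not> (point_less x p \<and> point_less p y)} \<union>
     {(x, p) | x. \<exists>y. (x, y) \<in> \<mu> \<and> point_less x p \<and> point_less p y} \<union>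
     {(p, y) | y. \<exists>x. (x, y) \<in> \<mu> \<and> point_less x p \<and> point_less p y}"

definition strands_of :: "arc \<Rightarrow> hclass \<Rightarrow> strands set" where
  "strands_of Z h = {\<mu> \<in> moving_strands Z. hgrading \<mu> = h}"

lemma point_less_trans: "point_less x y \<Longrightarrow> point_less y z \<Longrightarrow> point_less x z"
  by (auto simp: point_less_def)

lemma point_less_irrefl: "\<not> point_less x x"
  by (simp add: point_less_def)

lemma point_less_linear: "fst x = fst y \<Longrightarrow> x = y \<or> point_less x y \<or> point_less y x"
  by (auto simp: point_less_def prod_eq_iff)

lemma point_less_fst: "point_less x y \<Longrightarrow> fst x = fst y"
  by (simp add: point_less_def)

text \<open>A point strictly between two points of an interval is not one of the ends at
  infinity.\<close>

lemma point_less_places: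
  "x \<in> points Z \<Longrightarrow> y \<in> points Z \<Longrightarrow> point_less x p \<Longrightarrow> point_less p y \<Longrightarrow> p \<in> places Z"
  by (cases p) (auto simp: points_def places_def point_less_def)

lemma covers_start: "point_less x y \<Longrightarrow> covers x y x"
  by (auto simp: covers_def point_less_def)

lemma covers_end: "point_less x y \<Longrightarrow> covers x y (step_before y)"
  by (auto simp: covers_def point_less_def step_before_def)

lemma covers_interior: "point_less x p \<Longrightarrow> point_less p y \<Longrightarrow> covers x y p \<and> covers x y (step_before p)"
  by (auto simp: covers_def point_less_def step_before_def)

lemma covers_cases: "covers x y p \<Longrightarrow> x = p \<or> point_less x p \<and> point_less p y"
  by (cases "x = p") (auto simp: covers_def point_less_def prod_eq_iff)

text \<open>At the start of an interval, truncated subtraction makes \<open>step_before\<close>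
  return the step after it; \<open>1 \<le> snd p\<close> excludes this.\<close>

lemma covers_before_cases:
  "covers x y (step_before p) \<Longrightarrow> 1 \<le> snd p \<Longrightarrow> y = p \<or> point_less x p \<and> point_less p y"
  by (cases "y = p") (auto simp: covers_def point_less_def step_before_def prod_eq_iff)

lemma segment_class_covers: "segment_class x y e = (if covers x y e then 1 else 0)"
  by (simp add: segment_class_def covers_def)

lemma segment_class_add:
  "point_less x p \<Longrightarrow> point_less p y \<Longrightarrow> segment_class x p + segment_class p y = segment_class x y"
  by (rule ext) (auto simp: segment_class_def point_less_def)

lemma hgrading_apply:
  assumes "finite \<mu>"
  shows "hgrading \<mu> e = int (card {(x, y) \<in> \<mu>. covers x y e})"
proof -
  have "hgrading \<mu> e = (\<Sum>s\<in>\<mu>. if covers (fst s) (snd s) e then 1 else 0)"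
    unfolding hgrading_def sum_fun_apply
    by (rule sum.cong) (auto simp: segment_class_covers)
  also have "\<dots> = (\<Sum>s\<in>{s \<in> \<mu>. covers (fst s) (snd s) e}. 1)"
    by (rule sum.inter_filter[symmetric]) fact
  also have "{s \<in> \<mu>. covers (fst s) (snd s) e} = {(x, y) \<in> \<mu>. covers x y e}" by auto
  finally show ?thesis by simp
qed

locale viable_class =
  fixes Z :: arc and h :: hclass
  assumes H1: "h \<in> H1 Z" and viable: "viable Z h"
begin

lemma h_le_1: "h e \<le> 1"
proof (cases "e \<in> steps Z")
  case True
  then show ?thesis using viable by (auto simp: viable_def)
next
  case False
  then have "h e = 0" using H1 unfolding H1_def by blast
  then show ?thesis by simp
qed

text \<open>The multiplicity of h on a step counts the strands covering it and is at most 1.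
  Bijectivity of the strands is derived from this in \<open>strands_of_iff\<close>, so it must not
  be assumed here.\<close>

lemma cover_unique_aux:
  assumes \<mu>: "\<mu> \<subseteq> points Z \<times> points Z" "hgrading \<mu> = h"
    and xy: "(x, y) \<in> \<mu>" "(x', y') \<in> \<mu>" "covers x y e" "covers x' y' e"
  shows "x = x' \<and> y = y'"
proof -
  have fin: "finite \<mu>" using \<mu>(1) finite_points by (meson finite_SigmaI finite_subset)
  have "card {(x, y) \<in> \<mu>. covers x y e} \<le> 1"
    using hgrading_apply[OF fin, of e] \<mu>(2) h_le_1[of e] by simp
  moreover have "finite {(x, y) \<in> \<mu>. covers x y e}" using fin by (rule finite_subset[rotated]) auto
  ultimately have "\<forall>s\<in>{(x, y) \<in> \<mu>. covers x y e}. \<forall>s'\<in>{(x, y) \<in> \<mu>. covers x y e}. s = s'"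
    using card_le_Suc0_iff_eq[of "{(x, y) \<in> \<mu>. covers x y e}"] by simp
  then have "(x, y) = (x', y')" using xy by (elim ballE) auto
  then show ?thesis by simp
qed

text \<open>Injectivity of the strands, which \<open>strand_diagrams\<close> asks for, is automatic for a
  viable class, since no step is covered twice.\<close>

lemma strands_of_iff:
  "\<mu> \<in> strands_of Z h \<longleftrightarrow>
     \<mu> \<subseteq> points Z \<times> points Z \<and> (\<forall>(x, y)\<in>\<mu>. point_less x y) \<and> hgrading \<mu> = h"
  (is "_ \<longleftrightarrow> ?R \<mu>")
proof -
  show "\<mu> \<in> strands_of Z h \<longleftrightarrow> ?R \<mu>"
  proof
    assume \<mu>: "\<mu> \<in> strands_of Z h"
    have "point_less x y" if "(x, y) \<in> \<mu>" for x y
    proof -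
      have "point_le x y" "x \<noteq> y"
        using \<mu> that unfolding strands_of_def moving_strands_def strand_diagrams_def by blast+
      then show ?thesis by (auto simp: point_le_def point_less_def prod_eq_iff)
    qed
    then show "?R \<mu>"
      using \<mu> by (auto simp: strands_of_def moving_strands_def strand_diagrams_def)
  next
    assume R: "?R \<mu>"
    then have less: "point_less x y" if "(x, y) \<in> \<mu>" for x y using that by auto
    have "single_valued \<mu>"
      by (rule single_valuedI) (metis cover_unique_aux R covers_start less)
    moreover have "single_valued (\<mu>\<inverse>)"
      by (rule single_valuedI) (metis cover_unique_aux R covers_end less converseD)
    moreover have "\<forall>(x, y)\<in>\<mu>. point_le x y"
      using less unfolding point_le_def point_less_def by (blast intro: less_imp_le)
    moreover have "\<forall>x. (x, x) \<notin> \<mu>" using less point_less_irrefl by blast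
    ultimately show "\<mu> \<in> strands_of Z h"
      using R by (simp add: strands_of_def moving_strands_def strand_diagrams_def)
  qed
qed

lemma strands_less: "\<mu> \<in> strands_of Z h \<Longrightarrow> (x, y) \<in> \<mu> \<Longrightarrow> point_less x y"
  by (auto simp: strands_of_iff)

lemma strands_points: "\<mu> \<in> strands_of Z h \<Longrightarrow> (x, y) \<in> \<mu> \<Longrightarrow> x \<in> points Z \<and> y \<in> points Z"
  by (auto simp: strands_of_iff)

lemma cover_unique:
  "\<mu> \<in> strands_of Z h \<Longrightarrow> (x, y) \<in> \<mu> \<Longrightarrow> (x', y') \<in> \<mu> \<Longrightarrow> covers x y e \<Longrightarrow> covers x' y' e \<Longrightarrow>
    x = x' \<and> y = y'"
  using cover_unique_aux strands_of_iff by blast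

lemma finite_strands: "\<mu> \<in> strands_of Z h \<Longrightarrow> finite \<mu>"
  by (rule finite_subset[of _ "points Z \<times> points Z"]) (auto simp: strands_of_iff finite_points)

lemma finite_strands_of: "finite (strands_of Z h)"
proof (rule finite_subset)
  show "strands_of Z h \<subseteq> Pow (points Z \<times> points Z)" by (auto simp: strands_of_iff)
qed (simp add: finite_points)

lemma h_eq_1_iff:
  assumes "\<mu> \<in> strands_of Z h"
  shows "h e = 1 \<longleftrightarrow> (\<exists>x y. (x, y) \<in> \<mu> \<and> covers x y e)"
proof -
  have h: "h e = int (card {(x, y) \<in> \<mu>. covers x y e})"
    using hgrading_apply[OF finite_strands[OF assms]] assms by (simp add: strands_of_def)
  have "finite {(x, y) \<in> \<mu>. covers x y e}"
    using finite_strands[OF assms] by (rule finite_subset[rotated]) auto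
  then have "h e = 0 \<longleftrightarrow> {(x, y) \<in> \<mu>. covers x y e} = {}" using h by simp
  moreover have "h e = 1 \<longleftrightarrow> h e \<noteq> 0" using h h_le_1[of e] by auto
  ultimately show ?thesis by auto
qed

lemma h_cases:
  assumes "\<mu> \<in> strands_of Z h"
  shows "h e = 0 \<or> h e = 1"
  using hgrading_apply[OF finite_strands[OF assms], of e] assms h_le_1[of e]
  by (auto simp: strands_of_def)

definition through :: "point set" where
  "through = {p \<in> places Z. h p = 1 \<and> h (step_before p) = 1}"

lemma inside_through: "\<mu> \<in> strands_of Z h \<Longrightarrow> inside \<mu> \<subseteq> through"
  using point_less_places covers_interior strands_points
  unfolding inside_def through_def by (blast intro: h_eq_1_iff[THEN iffD2])

text \<open>A strand covering the step that leaves p either starts at p or passes over p, and no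
  second strand covers this step. So h and \<open>inside\<close> determine the starts;
  \<open>Range_strands_iff\<close> treats the ends.\<close>

lemma Domain_strands_iff:
  assumes "\<mu> \<in> strands_of Z h"
  shows "p \<in> Domain \<mu> \<longleftrightarrow> h p = 1 \<and> p \<notin> inside \<mu>"
proof
  assume "p \<in> Domain \<mu>"
  then obtain y where y: "(p, y) \<in> \<mu>" by auto
  then have c: "covers p y p" using covers_start strands_less[OF assms] by blast
  then have "h p = 1" using h_eq_1_iff[OF assms] y by blast
  moreover have "p \<notin> inside \<mu>"
  proof
    assume "p \<in> inside \<mu>"
    then obtain a b where ab: "(a, b) \<in> \<mu>" "point_less a p" "point_less p b"
      by (auto simp: inside_def)
    then have "a = p" using cover_unique[OF assms ab(1) y _ c] covers_interior by blast
    then show False using ab point_less_irrefl by blast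
  qed
  ultimately show "h p = 1 \<and> p \<notin> inside \<mu>" by simp
next
  assume "h p = 1 \<and> p \<notin> inside \<mu>"
  then obtain x y where "(x, y) \<in> \<mu>" "covers x y p" "p \<notin> inside \<mu>" using h_eq_1_iff[OF assms] by blast
  then show "p \<in> Domain \<mu>" using covers_cases unfolding inside_def by blast
qed

lemma Range_strands_iff:
  assumes "\<mu> \<in> strands_of Z h"
  shows "p \<in> Range \<mu> \<longleftrightarrow> 1 \<le> snd p \<and> h (step_before p) = 1 \<and> p \<notin> inside \<mu>"
proof
  assume "p \<in> Range \<mu>"
  then obtain x where x: "(x, p) \<in> \<mu>" by auto
  then have l: "point_less x p" using strands_less[OF assms] by blast
  then have c: "covers x p (step_before p)" using covers_end by blast
  then have "h (step_before p) = 1" using h_eq_1_iff[OF assms] x by blast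
  moreover have "1 \<le> snd p" using l by (simp add: point_less_def)
  moreover have "p \<notin> inside \<mu>"
  proof
    assume "p \<in> inside \<mu>"
    then obtain a b where ab: "(a, b) \<in> \<mu>" "point_less a p" "point_less p b"
      by (auto simp: inside_def)
    then have "b = p" using cover_unique[OF assms ab(1) x _ c] covers_interior by blast
    then show False using ab point_less_irrefl by blast
  qed
  ultimately show "1 \<le> snd p \<and> h (step_before p) = 1 \<and> p \<notin> inside \<mu>" by simp
next
  assume p: "1 \<le> snd p \<and> h (step_before p) = 1 \<and> p \<notin> inside \<mu>"
  then obtain x y where "(x, y) \<in> \<mu>" "covers x y (step_before p)" using h_eq_1_iff[OF assms] by blast
  then show "p \<in> Range \<mu>" using covers_before_cases p unfolding inside_def by blast
qed

text \<open>A strand ends at the first end point after its start, since end points are never in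
  \<open>inside\<close> while everything a strand passes over is. With the descriptions of
  \<open>Domain\<close> and \<open>Range\<close> this recovers the strands from
  \<open>inside\<close>.\<close>

lemma strands_iff:
  assumes "\<mu> \<in> strands_of Z h"
  shows "(x, y) \<in> \<mu> \<longleftrightarrow> x \<in> Domain \<mu> \<and> y \<in> Range \<mu> \<and> point_less x y \<and>
    (\<forall>p. point_less x p \<longrightarrow> point_less p y \<longrightarrow> p \<in> inside \<mu>)"
proof
  assume "(x, y) \<in> \<mu>"
  then show "x \<in> Domain \<mu> \<and> y \<in> Range \<mu> \<and> point_less x y \<and>
    (\<forall>p. point_less x p \<longrightarrow> point_less p y \<longrightarrow> p \<in> inside \<mu>)"
    using strands_less[OF assms] unfolding inside_def by blast
next
  assume a: "x \<in> Domain \<mu> \<and> y \<in> Range \<mu> \<and> point_less x y \<and>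
    (\<forall>p. point_less x p \<longrightarrow> point_less p y \<longrightarrow> p \<in> inside \<mu>)"
  then obtain z where z: "(x, z) \<in> \<mu>" by auto
  have xz: "point_less x z" using strands_less[OF assms z] .
  have "\<not> point_less z y" using a xz z Range_strands_iff[OF assms, of z] by blast
  moreover have "\<not> point_less y z" using a z Range_strands_iff[OF assms, of y] unfolding inside_def by blast
  moreover have "fst z = fst y" using a xz by (auto simp: point_less_def)
  ultimately show "(x, y) \<in> \<mu>" using z point_less_linear by metis
qed

lemma strands_eqI:
  assumes "\<mu> \<in> strands_of Z h" "\<nu> \<in> strands_of Z h" "inside \<mu> = inside \<nu>"
  shows "\<mu> = \<nu>"
proof -
  have "Domain \<mu> = Domain \<nu>" "Range \<mu> = Range \<nu>"
    using Domain_strands_iff[OF assms(1)] Domain_strands_iff[OF assms(2)]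
      Range_strands_iff[OF assms(1)] Range_strands_iff[OF assms(2)] assms(3) by (simp_all add: set_eq_iff)
  then show ?thesis
    using strands_iff[OF assms(1)] strands_iff[OF assms(2)] assms(3) by (simp add: set_eq_iff)
qed

text \<open>By \<open>breaks_iff\<close>, the places where one strand ends and another begins. The
  form as a complement shows that \<open>breaks\<close> and \<open>inside\<close> carry the same
  information.\<close>

definition breaks :: "strands \<Rightarrow> point set" where
  "breaks \<mu> = through - inside \<mu>"

lemma breaks_iff:
  assumes "\<mu> \<in> strands_of Z h"
  shows "p \<in> breaks \<mu> \<longleftrightarrow> p \<in> Domain \<mu> \<and> p \<in> Range \<mu>"
proof
  assume "p \<in> breaks \<mu>"
  then show "p \<in> Domain \<mu> \<and> p \<in> Range \<mu>"
    using Domain_strands_iff[OF assms] Range_strands_iff[OF assms] by (auto simp: breaks_def through_def places_def)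
next
  assume a: "p \<in> Domain \<mu> \<and> p \<in> Range \<mu>"
  then obtain x y where xy: "(x, p) \<in> \<mu>" "(p, y) \<in> \<mu>" by auto
  then have "p \<in> places Z"
    using point_less_places strands_less[OF assms] strands_points[OF assms] by metis
  then show "p \<in> breaks \<mu>"
    using a Domain_strands_iff[OF assms] Range_strands_iff[OF assms] by (auto simp: breaks_def through_def)
qed

lemma strands_eqI_breaks:
  assumes "\<mu> \<in> strands_of Z h" "\<nu> \<in> strands_of Z h" "breaks \<mu> = breaks \<nu>"
  shows "\<mu> = \<nu>"
  using assms(3) inside_through[OF assms(1)] inside_through[OF assms(2)]
  by (intro strands_eqI[OF assms(1,2)]) (auto simp: breaks_def)

lemma break_at_eq:
  assumes \<mu>: "\<mu> \<in> strands_of Z h" and ab: "(a, b) \<in> \<mu>" "point_less a p" "point_less p b"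
  shows "break_at p \<mu> = insert (a, p) (insert (p, b) (\<mu> - {(a, b)}))"
    and "break_at p \<mu> \<in> strands_of Z h"
    and "inside (break_at p \<mu>) = inside \<mu> - {p}"
proof -
  have unique: "x = a \<and> y = b" if "(x, y) \<in> \<mu>" "point_less x p" "point_less p y" for x y
    using cover_unique[OF \<mu> that(1) ab(1)] covers_interior that ab by blast
  show eq: "break_at p \<mu> = insert (a, p) (insert (p, b) (\<mu> - {(a, b)}))"
  proof -
    have iff: "(x, y) \<in> \<mu> \<and> point_less x p \<and> point_less p y \<longleftrightarrow> x = a \<and> y = b" for x y
      using unique ab by blast
    then have "{(x, y) \<in> \<mu>. \<not> (point_less x p \<and> point_less p y)} = \<mu> - {(a, b)}" by blast
    then show ?thesis unfolding break_at_def iff by blast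
  qed
  \<comment> \<open>Neither half is already a strand, as it would share a step with (a, b). So
    inserting both halves adds both of their classes to \<open>hgrading\<close>.\<close>
  have "(a, p) \<notin> \<mu>"
    using cover_unique[OF \<mu> _ ab(1), of a p a] covers_start[OF ab(2)] ab(3)
      covers_start[OF point_less_trans[OF ab(2,3)]] point_less_irrefl by blast
  moreover have "(p, b) \<notin> \<mu>"
    using cover_unique[OF \<mu> _ ab(1), of p b p] covers_start[OF ab(3)] covers_interior[OF ab(2,3)] ab(2)
      point_less_irrefl by blast
  moreover have "(a, p) \<noteq> (p, b)" using ab(2) point_less_irrefl by (metis prod.inject)
  ultimately have "hgrading (insert (a, p) (insert (p, b) (\<mu> - {(a, b)}))) =
      segment_class a p + (segment_class p b + hgrading (\<mu> - {(a, b)}))"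
    using finite_strands[OF \<mu>] by (simp add: hgrading_def)
  also have "\<dots> = segment_class a b + hgrading (\<mu> - {(a, b)})"
    using segment_class_add ab by (metis add.assoc)
  also have "\<dots> = hgrading \<mu>"
    using finite_strands[OF \<mu>] ab(1) sum.remove[of \<mu> "(a, b)" "\<lambda>(x, y). segment_class x y"]
    by (simp add: hgrading_def)
  finally have "hgrading (break_at p \<mu>) = h" using \<mu> eq by (simp add: strands_of_def)
  moreover have "p \<in> points Z"
    using point_less_places strands_points[OF \<mu> ab(1)] ab places_points by metis
  ultimately show br: "break_at p \<mu> \<in> strands_of Z h"
    using \<mu> ab unfolding eq strands_of_iff by auto
  have "p \<in> Domain (break_at p \<mu>)" using eq by auto
  then have "p \<notin> inside (break_at p \<mu>)" using Domain_strands_iff[OF br] by blast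
  moreover have "inside (break_at p \<mu>) \<subseteq> inside \<mu>"
    unfolding eq inside_def using ab point_less_trans by blast
  moreover have "inside \<mu> \<subseteq> insert p (inside (break_at p \<mu>))"
  proof
    fix z assume "z \<in> inside \<mu>"
    then obtain x y where xy: "(x, y) \<in> \<mu>" "point_less x z" "point_less z y" by (auto simp: inside_def)
    show "z \<in> insert p (inside (break_at p \<mu>))"
    proof (cases "(x, y) = (a, b)")
      case True
      then have "fst z = fst p" using xy ab point_less_fst by (metis prod.inject)
      then have "z = p \<or> point_less z p \<or> point_less p z" by (rule point_less_linear)
      then show ?thesis unfolding eq inside_def using True xy by blast
    next
      case False
      then show ?thesis unfolding eq inside_def using xy by blast
    qed
  qed
  ultimately show "inside (break_at p \<mu>) = inside \<mu> - {p}" by blast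
qed

lemma insideE:
  assumes "p \<in> inside \<mu>"
  obtains a b where "(a, b) \<in> \<mu>" "point_less a p" "point_less p b"
  using assms by (auto simp: inside_def)

lemma break_at:
  assumes \<mu>: "\<mu> \<in> strands_of Z h" and p: "p \<in> inside \<mu>"
  shows break_at_strands: "break_at p \<mu> \<in> strands_of Z h"
    and inside_break_at: "inside (break_at p \<mu>) = inside \<mu> - {p}"
    and Domain_break_at: "Domain (break_at p \<mu>) = insert p (Domain \<mu>)"
    and Range_break_at: "Range (break_at p \<mu>) = insert p (Range \<mu>)"
    and breaks_break_at: "breaks (break_at p \<mu>) = insert p (breaks \<mu>)"
proof -
  obtain a b where ab: "(a, b) \<in> \<mu>" "point_less a p" "point_less p b" using p by (rule insideE)
  note br = break_at_eq[OF \<mu> ab]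
  show "break_at p \<mu> \<in> strands_of Z h" "inside (break_at p \<mu>) = inside \<mu> - {p}" by fact+
  have t: "p \<in> through" using inside_through[OF \<mu>] p by blast
  show "breaks (break_at p \<mu>) = insert p (breaks \<mu>)" using br(3) t by (auto simp: breaks_def)
  show "Domain (break_at p \<mu>) = insert p (Domain \<mu>)" "Range (break_at p \<mu>) = insert p (Range \<mu>)"
    unfolding br(1) using ab(1) by auto
qed

lemma join_at:
  assumes \<mu>: "\<mu> \<in> strands_of Z h" and p: "p \<in> breaks \<mu>"
  shows join_at_strands: "join_at p \<mu> \<in> strands_of Z h"
    and inside_join_at: "inside (join_at p \<mu>) = insert p (inside \<mu>)"
    and Domain_join_at: "Domain (join_at p \<mu>) = Domain \<mu> - {p}"
    and Range_join_at: "Range (join_at p \<mu>) = Range \<mu> - {p}"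
    and breaks_join_at: "breaks (join_at p \<mu>) = breaks \<mu> - {p}"
proof -
  obtain a b where ab: "(a, p) \<in> \<mu>" "(p, b) \<in> \<mu>" using breaks_iff[OF \<mu>] p by auto
  have less: "point_less a p" "point_less p b" using strands_less[OF \<mu>] ab by auto
  then have less': "point_less a b" by (rule point_less_trans)
  have end_unique: "x = a" if "(x, p) \<in> \<mu>" for x
    using cover_unique[OF \<mu> that ab(1)] covers_end strands_less[OF \<mu>] that ab by blast
  have start_unique: "y = b" if "(p, y) \<in> \<mu>" for y
    using cover_unique[OF \<mu> that ab(2)] covers_start strands_less[OF \<mu>] that ab by blast
  have eq: "join_at p \<mu> = insert (a, b) (\<mu> - {(a, p), (p, b)})"
    unfolding join_at_def using end_unique start_unique ab less point_less_irrefl by blast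
  have "(a, b) \<notin> \<mu>"
    using cover_unique[OF \<mu> _ ab(1), of a b a] covers_start[OF less(1)] covers_start[OF less'] less(2)
      point_less_irrefl by blast
  then have "hgrading (insert (a, b) (\<mu> - {(a, p), (p, b)})) =
      segment_class a b + hgrading (\<mu> - {(a, p), (p, b)})"
    using finite_strands[OF \<mu>] by (simp add: hgrading_def)
  also have "\<dots> = segment_class a p + (segment_class p b + hgrading (\<mu> - {(a, p), (p, b)}))"
    using segment_class_add[OF less] by (metis add.assoc)
  also have "segment_class p b + hgrading (\<mu> - {(a, p), (p, b)}) = hgrading (\<mu> - {(a, p)})"
  proof -
    have "(p, b) \<in> \<mu> - {(a, p)}" using ab less point_less_irrefl by (metis Diff_iff prod.inject singletonD)
    then have "hgrading (\<mu> - {(a, p)}) = segment_class p b + hgrading (\<mu> - {(a, p)} - {(p, b)})"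
      using finite_strands[OF \<mu>]
        sum.remove[of "\<mu> - {(a, p)}" "(p, b)" "\<lambda>(x, y). segment_class x y"]
      by (simp add: hgrading_def)
    moreover have "\<mu> - {(a, p)} - {(p, b)} = \<mu> - {(a, p), (p, b)}" by blast
    ultimately show ?thesis by simp
  qed
  also have "segment_class a p + hgrading (\<mu> - {(a, p)}) = hgrading \<mu>"
    using finite_strands[OF \<mu>] ab(1) sum.remove[of \<mu> "(a, p)" "\<lambda>(x, y). segment_class x y"]
    by (simp add: hgrading_def)
  finally have "hgrading (join_at p \<mu>) = h" using \<mu> eq by (simp add: strands_of_def)
  then show jo: "join_at p \<mu> \<in> strands_of Z h"
    using \<mu> ab less' unfolding eq strands_of_iff by auto
  have neq: "a \<noteq> p" "b \<noteq> p" using less point_less_irrefl by metis+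
  have "(\<exists>y. (x, y) \<in> join_at p \<mu>) \<longleftrightarrow> (\<exists>y. (x, y) \<in> \<mu>) \<and> x \<noteq> p" for x
    unfolding eq using start_unique ab neq by blast
  then show "Domain (join_at p \<mu>) = Domain \<mu> - {p}" by (simp add: set_eq_iff Domain.simps)
  have "(\<exists>x. (x, y) \<in> join_at p \<mu>) \<longleftrightarrow> (\<exists>x. (x, y) \<in> \<mu>) \<and> y \<noteq> p" for y
    unfolding eq using end_unique ab neq by blast
  then show "Range (join_at p \<mu>) = Range \<mu> - {p}" by (simp add: set_eq_iff Range.simps)
  have "z \<in> inside (join_at p \<mu>) \<longleftrightarrow> z = p \<or> z \<in> inside \<mu>" for z
  proof
    assume "z \<in> inside (join_at p \<mu>)"
    then obtain x y where xy: "(x, y) \<in> join_at p \<mu>" "point_less x z" "point_less z y" by (rule insideE)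
    show "z = p \<or> z \<in> inside \<mu>"
    proof (cases "(x, y) = (a, b)")
      case True
      then have "fst z = fst p" using xy less point_less_fst by (metis prod.inject)
      then have "z = p \<or> point_less z p \<or> point_less p z" by (rule point_less_linear)
      then show ?thesis unfolding inside_def using True xy ab by blast
    next
      case False
      then show ?thesis using xy unfolding eq inside_def by blast
    qed
  next
    assume "z = p \<or> z \<in> inside \<mu>"
    then show "z \<in> inside (join_at p \<mu>)"
    proof
      assume "z = p"
      then show ?thesis using less unfolding eq inside_def by blast
    next
      assume "z \<in> inside \<mu>"
      then obtain x y where xy: "(x, y) \<in> \<mu>" "point_less x z" "point_less z y" by (rule insideE)
      consider "(x, y) = (a, p)" | "(x, y) = (p, b)" | "(x, y) \<notin> {(a, p), (p, b)}" by blast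
      then show ?thesis
        using xy less point_less_trans unfolding eq inside_def by cases blast+
    qed
  qed
  then show I: "inside (join_at p \<mu>) = insert p (inside \<mu>)" by blast
  then show "breaks (join_at p \<mu>) = breaks \<mu> - {p}" by (auto simp: breaks_def)
qed

lemma join_at_break_at:
  assumes "\<mu> \<in> strands_of Z h" "p \<in> inside \<mu>"
  shows "join_at p (break_at p \<mu>) = \<mu>"
proof (rule strands_eqI)
  note br = break_at[OF assms]
  have p: "p \<in> breaks (break_at p \<mu>)" by (simp add: br(5))
  show "join_at p (break_at p \<mu>) \<in> strands_of Z h" by (rule join_at_strands[OF br(1) p])
  show "inside (join_at p (break_at p \<mu>)) = inside \<mu>"
    using assms(2) by (simp add: inside_join_at[OF br(1) p] br(2) insert_absorb)
qed (rule assms(1))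

end

section \<open>Diagrams as indicator functions\<close>

lemma sum_single:
  assumes "finite I" "inj_on f I"
  shows "(\<Sum>i\<in>I. single (f i)) = indicator (f ` I)"
proof
  fix D
  have "(\<Sum>i\<in>I. single (f i)) D = (\<Sum>i\<in>I. if D = f i then 1 else 0)"
    by (simp add: sum_fun_apply single_def)
  also have "\<dots> = indicator (f ` I) D"
  proof (cases "D \<in> f ` I")
    case True
    then obtain j where j: "j \<in> I" "D = f j" by auto
    then have "(\<Sum>i\<in>I. if D = f i then 1 else 0) = (\<Sum>i\<in>I. if i = j then 1 else (0::bit))"
      using assms(2) by (intro sum.cong) (auto dest: inj_onD)
    then show ?thesis using j True assms(1) by simp
  next
    case False
    then have "(\<Sum>i\<in>I. if D = f i then 1 else 0) = (\<Sum>i\<in>I. (0::bit))"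
      by (intro sum.cong) auto
    then show ?thesis using False by simp
  qed
  finally show "(\<Sum>i\<in>I. single (f i)) D = indicator (f ` I) D" .
qed

text \<open>Evaluating a linear relation at a point of X j isolates the coefficient of j, by
  disjointness.\<close>

lemma independent_indicators:
  fixes X :: "'i \<Rightarrow> strands set"
  assumes fin: "finite I" and ne: "\<And>i. i \<in> I \<Longrightarrow> X i \<noteq> {}"
    and disj: "\<And>i j. i \<in> I \<Longrightarrow> j \<in> I \<Longrightarrow> i \<noteq> j \<Longrightarrow> X i \<inter> X j = {}"
  shows "inj_on (\<lambda>i. indicator (X i) :: chain) I"
    and "chain.independent ((\<lambda>i. indicator (X i)) ` I)"
proof -
  let ?e = "\<lambda>i. indicator (X i) :: chain"
  show inj: "inj_on ?e I"
  proof (rule inj_onI, rule ccontr)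
    fix i j assume ij: "i \<in> I" "j \<in> I" "?e i = ?e j" "i \<noteq> j"
    obtain D where "D \<in> X i" using ne[OF ij(1)] by blast
    moreover then have "D \<notin> X j" using disj[OF ij(1,2,4)] by blast
    ultimately show False using fun_cong[OF ij(3), of D] by simp
  qed
  show "chain.independent (?e ` I)"
  proof (rule chain.independent_if_scalars_zero)
    show "finite (?e ` I)" using fin by simp
    fix f v assume sum: "(\<Sum>x\<in>?e ` I. chain_scale (f x) x) = 0" and "v \<in> ?e ` I"
    then obtain j where j: "j \<in> I" "v = ?e j" by blast
    obtain D where D: "D \<in> X j" using ne[OF j(1)] by blast
    have "(\<Sum>i\<in>I. chain_scale (f (?e i)) (?e i)) = 0"
      using sum sum.reindex[OF inj, of "\<lambda>x. chain_scale (f x) x"] by simp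
    then have "0 = (\<Sum>i\<in>I. chain_scale (f (?e i)) (?e i)) D" by simp
    also have "\<dots> = (\<Sum>i\<in>I. if i = j then f (?e j) else 0)"
      unfolding sum_fun_apply chain_scale_def
    proof (rule sum.cong[OF refl])
      fix i assume i: "i \<in> I"
      show "f (?e i) * ?e i D = (if i = j then f (?e j) else 0)"
        using D disj[OF i j(1)] by (cases "i = j") (auto simp: indicator_def)
    qed
    also have "\<dots> = f (?e j)" using fin j(1) by simp
    finally show "f v = 0" using j(2) by simp
  qed
qed

lemma finite_strand_diagrams: "finite (strand_diagrams Z)"
  by (rule finite_subset[of _ "Pow (points Z \<times> points Z)"])
    (auto simp: strand_diagrams_def finite_points)

lemma inv_number_Id_on: "inv_number (Id_on S) = 0"
proof -
  have "inversions (Id_on S) = {}" by (auto simp: inversions_def point_less_def)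
  then show ?thesis by (simp add: inv_number_def)
qed

lemma strand_mult_Id_on:
  "strand_mult (Id_on S) E = (if Domain E = S then single E else 0)"
  "strand_mult E (Id_on S) = (if Range E = S then single E else 0)"
proof -
  have "Id_on S O E = E" if "Domain E = S" using that by auto
  moreover have "E O Id_on S = E" if "Range E = S" using that by auto
  ultimately show "strand_mult (Id_on S) E = (if Domain E = S then single E else 0)"
    "strand_mult E (Id_on S) = (if Range E = S then single E else 0)"
    by (auto simp: strand_mult_def inv_number_Id_on)
qed

lemma Id_on_strand_diagrams: "S \<subseteq> points Z \<Longrightarrow> Id_on S \<in> strand_diagrams Z"
  by (auto simp: strand_diagrams_def single_valued_def point_le_def)

lemma Id_on_eq_iff: "Id_on S = Id_on T \<longleftrightarrow> S = T"
  by (metis Domain_Id_on)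

lemma sections_points: "S \<in> sections Z s \<Longrightarrow> S \<subseteq> points Z"
  by (simp add: sections_def)

lemma idem_eq: "idem Z s = indicator (Id_on ` sections Z s)"
proof -
  have "finite (sections Z s)"
    by (rule finite_subset[of _ "Pow (points Z)"]) (auto simp: sections_def finite_points)
  then show ?thesis unfolding idem_def by (intro sum_single) (simp_all add: inj_on_def Id_on_eq_iff)
qed

text \<open>For each E only one identity diagram gives a nonzero product, the one on
  \<open>Domain E\<close> or \<open>Range E\<close>, and it occurs in \<open>idem\<close> exactly if
  that set is a section. In \<open>scale\<close> and \<open>aux\<close> the set is called T, so that
  both sides are treated at once.\<close>

lemma chain_mult_idem:
  assumes X: "X \<subseteq> strand_diagrams Z"
  shows "chain_mult Z (idem Z s) (indicator X) = indicator {E \<in> X. Domain E \<in> sections Z s}"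
    and "chain_mult Z (indicator X) (idem Z s) = indicator {E \<in> X. Range E \<in> sections Z s}"
proof -
  let ?S = "strand_diagrams Z"
  have scale: "chain_scale (idem Z s D * indicator X E) (m D) =
      (if D = Id_on T then (if T \<in> sections Z s \<and> E \<in> X then single E else 0) else 0)"
    if m: "\<And>S. m (Id_on S) = (if T = S then single E else 0)" for D E T m
  proof (cases "D \<in> Id_on ` sections Z s")
    case True
    then obtain S where S: "S \<in> sections Z s" "D = Id_on S" by blast
    then have "idem Z s D = 1" by (simp add: idem_eq)
    then show ?thesis using S by (cases "E \<in> X") (auto simp: m Id_on_eq_iff)
  next
    case False
    then have "idem Z s D = 0" by (simp add: idem_eq)
    then show ?thesis using False by auto
  qed
  have aux: "(\<Sum>D\<in>?S. g D) = (if T \<in> sections Z s \<and> E \<in> X then single E else 0)"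
    if g: "\<And>D. g D = (if D = Id_on T then (if T \<in> sections Z s \<and> E \<in> X then single E else 0) else 0)"
    for g and T and E
  proof (cases "T \<in> sections Z s")
    case True
    then have "Id_on T \<in> ?S" using Id_on_strand_diagrams sections_points by blast
    then show ?thesis using finite_strand_diagrams by (simp add: g)
  next
    case False
    then show ?thesis by (simp add: g)
  qed
  have single: "(\<Sum>E\<in>?S. if P E \<and> E \<in> X then single E else 0) = indicator {E \<in> X. P E}" for P
  proof -
    have "(\<Sum>E\<in>?S. if P E \<and> E \<in> X then single E else 0) = (\<Sum>E\<in>{E \<in> ?S. P E \<and> E \<in> X}. single E)"
      by (rule sum.inter_filter[symmetric, OF finite_strand_diagrams])
    also have "{E \<in> ?S. P E \<and> E \<in> X} = {E \<in> X. P E}" using X by auto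
    also have "(\<Sum>E\<in>{E \<in> X. P E}. single E) = indicator {E \<in> X. P E}"
      using sum_single[of "{E \<in> X. P E}" "\<lambda>E. E"] X finite_strand_diagrams
      by (simp add: finite_subset)
    finally show ?thesis .
  qed
  have "chain_scale (idem Z s D * indicator X E) (strand_mult D E) =
      (if D = Id_on (Domain E) then (if Domain E \<in> sections Z s \<and> E \<in> X then single E else 0) else 0)" for D E
    by (rule scale) (rule strand_mult_Id_on)
  then have "(\<Sum>D\<in>?S. chain_scale (idem Z s D * indicator X E) (strand_mult D E)) =
      (if Domain E \<in> sections Z s \<and> E \<in> X then single E else 0)" for E
    by (rule aux)
  then show "chain_mult Z (idem Z s) (indicator X) = indicator {E \<in> X. Domain E \<in> sections Z s}"
    unfolding chain_mult_def by (subst sum.swap) (simp add: single)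
  have "chain_scale (indicator X E * idem Z s D) (strand_mult E D) =
      (if D = Id_on (Range E) then (if Range E \<in> sections Z s \<and> E \<in> X then single E else 0) else 0)" for D E
    by (subst mult.commute, rule scale) (rule strand_mult_Id_on)
  then have "(\<Sum>D\<in>?S. chain_scale (indicator X E * idem Z s D) (strand_mult E D)) =
      (if Range E \<in> sections Z s \<and> E \<in> X then single E else 0)" for E
    by (rule aux)
  then show "chain_mult Z (indicator X) (idem Z s) = indicator {E \<in> X. Range E \<in> sections Z s}"
    unfolding chain_mult_def by (simp add: single)
qed

text \<open>The choices of horizontal strands that complete \<mu> to a summand of the diagram from s
  to t. By \<open>diagram_eq\<close> they index all its summands.\<close>

definition horizontals :: "arc \<Rightarrow> nat set \<Rightarrow> strands \<Rightarrow> nat set \<Rightarrow> point set set" where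
  "horizontals Z s \<mu> t = {U. U \<subseteq> points Z - (Domain \<mu> \<union> Range \<mu>) \<and>
     Domain \<mu> \<union> U \<in> sections Z s \<and> Range \<mu> \<union> U \<in> sections Z t}"

lemma finite_horizontals: "finite (horizontals Z s \<mu> t)"
  by (rule finite_subset[of _ "Pow (points Z)"]) (auto simp: horizontals_def finite_points)

lemma inj_add_horizontals:
  assumes "\<mu> \<in> moving_strands Z"
  shows "inj (\<lambda>U. \<mu> \<union> Id_on U)"
proof (rule injI)
  fix U V assume eq: "\<mu> \<union> Id_on U = \<mu> \<union> Id_on V"
  have "x \<in> W \<longleftrightarrow> (x, x) \<in> \<mu> \<union> Id_on W" for x W
    using assms unfolding moving_strands_def by blast
  then show "U = V" using eq by blast
qed

lemma moving_strand_diagrams: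
  assumes "\<mu> \<in> moving_strands Z" "U \<subseteq> points Z - (Domain \<mu> \<union> Range \<mu>)"
  shows "\<mu> \<union> Id_on U \<in> strand_diagrams Z"
proof -
  have \<mu>: "\<mu> \<subseteq> points Z \<times> points Z" "single_valued \<mu>" "single_valued (\<mu>\<inverse>)" "\<forall>(x, y)\<in>\<mu>. point_le x y"
    using assms(1) by (auto simp: moving_strands_def strand_diagrams_def)
  have "single_valued (\<mu> \<union> Id_on U)" "single_valued ((\<mu> \<union> Id_on U)\<inverse>)"
    using \<mu>(2,3) assms(2) unfolding single_valued_def by blast+
  then show ?thesis using \<mu>(1,4) assms(2) unfolding strand_diagrams_def
    by (auto simp: point_le_def)
qed

lemma diagram_eq:
  assumes \<mu>: "\<mu> \<in> moving_strands Z"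
  shows "diagram Z s \<mu> t = indicator ((\<lambda>U. \<mu> \<union> Id_on U) ` horizontals Z s \<mu> t)"
proof -
  let ?P = "Pow (points Z - (Domain \<mu> \<union> Range \<mu>))"
  let ?X = "(\<lambda>U. \<mu> \<union> Id_on U) ` ?P"
  have "add_horizontals Z \<mu> = indicator ?X"
    unfolding add_horizontals_def using inj_add_horizontals[OF \<mu>]
    by (intro sum_single) (auto simp: finite_points intro: inj_on_subset)
  moreover have X: "?X \<subseteq> strand_diagrams Z" using moving_strand_diagrams[OF \<mu>] by auto
  moreover have "{E \<in> {E \<in> ?X. Domain E \<in> sections Z s}. Range E \<in> sections Z t} =
      (\<lambda>U. \<mu> \<union> Id_on U) ` horizontals Z s \<mu> t"
  proof -
    have "{E \<in> {E \<in> ?X. Domain E \<in> sections Z s}. Range E \<in> sections Z t} = (\<lambda>U. \<mu> \<union> Id_on U) `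
        {U \<in> ?P. Domain (\<mu> \<union> Id_on U) \<in> sections Z s \<and> Range (\<mu> \<union> Id_on U) \<in> sections Z t}"
      by blast
    also have "{U \<in> ?P. Domain (\<mu> \<union> Id_on U) \<in> sections Z s \<and> Range (\<mu> \<union> Id_on U) \<in> sections Z t} =
        horizontals Z s \<mu> t"
      by (simp add: horizontals_def Domain_Un_eq Range_Un_eq)
    finally show ?thesis .
  qed
  moreover have "{E \<in> ?X. Domain E \<in> sections Z s} \<subseteq> strand_diagrams Z" using X by auto
  ultimately show ?thesis by (simp only: diagram_def chain_mult_idem)
qed

lemma diagram_nonzero_iff:
  assumes "\<mu> \<in> moving_strands Z"
  shows "diagram Z s \<mu> t \<noteq> 0 \<longleftrightarrow> horizontals Z s \<mu> t \<noteq> {}"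
  unfolding diagram_eq[OF assms] by (auto simp: fun_eq_iff indicator_def)

lemma diff_indicator:
  assumes "X \<subseteq> strand_diagrams Z"
  shows "diff Z (indicator X) = (\<Sum>D\<in>X. strand_diff D)"
proof -
  have "diff Z (indicator X) = (\<Sum>D\<in>strand_diagrams Z. if D \<in> X then strand_diff D else 0)"
    unfolding diff_def by (rule sum.cong) (auto simp: indicator_def chain_scale_def)
  also have "\<dots> = (\<Sum>D\<in>{D \<in> strand_diagrams Z. D \<in> X}. strand_diff D)"
    by (rule sum.inter_filter[symmetric, OF finite_strand_diagrams])
  also have "{D \<in> strand_diagrams Z. D \<in> X} = X" using assms by auto
  finally show ?thesis .
qed

lemma linear_diff: "Vector_Spaces.linear chain_scale chain_scale (diff Z)"
proof -
  have "diff Z (v + w) = diff Z v + diff Z w" for v w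
    by (simp only: diff_def plus_fun_apply chain.scale_left_distrib sum.distrib)
  moreover have "diff Z (chain_scale c v) = chain_scale c (diff Z v)" for c v
  proof -
    have "chain_scale (chain_scale c v D) w = chain_scale c (chain_scale (v D) w)" for D w
      by (simp only: chain_scale_def mult.assoc)
    then show ?thesis by (simp only: diff_def chain.scale_sum_right)
  qed
  ultimately show ?thesis by unfold_locales
qed

section \<open>Crossings and their resolutions in a viable class\<close>

context viable_class
begin

text \<open>Two moving strands never cross, since both would cover the step leaving the later of
  their starts. So a crossing consists of a moving strand and a horizontal strand at a point it
  passes over.\<close>

lemma inversions_add_horizontals:
  assumes \<mu>: "\<mu> \<in> strands_of Z h"
  shows "inversions (\<mu> \<union> Id_on U) =
    {((a, b), (p, p)) | a b p. (a, b) \<in> \<mu> \<and> p \<in> U \<and> point_less a p \<and> point_less p b}"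
    (is "?L = ?R")
proof (intro equalityI subsetI)
  fix c assume "c \<in> ?L"
  then obtain x x' y y' where c: "c = ((x, x'), (y, y'))" "(x, x') \<in> \<mu> \<union> Id_on U"
    "(y, y') \<in> \<mu> \<union> Id_on U" "point_less x y" "point_less y' x'"
    unfolding inversions_def by blast
  have le: "fst u = fst v \<and> snd u \<le> snd v" if "(u, v) \<in> \<mu> \<union> Id_on U" for u v
    using that strands_less[OF \<mu>, of u v] by (auto simp: point_less_def)
  have "(x, x') \<notin> Id_on U"
    using le[OF c(3)] c(4,5) by (auto simp: point_less_def)
  then have x: "(x, x') \<in> \<mu>" using c(2) by blast
  have "(y, y') \<notin> \<mu>"
  proof
    assume y: "(y, y') \<in> \<mu>"
    have "covers x x' y" using c(4,5) le[OF c(3)] by (auto simp: covers_def point_less_def)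
    moreover have "covers y y' y" using strands_less[OF \<mu> y] by (rule covers_start)
    ultimately have "x = y" using cover_unique[OF \<mu> x y] by blast
    then show False using c(4) point_less_irrefl by blast
  qed
  then show "c \<in> ?R" using c x by blast
next
  fix c assume "c \<in> ?R"
  then show "c \<in> ?L" unfolding inversions_def by blast
qed

text \<open>A point is passed over by at most one strand, so crossings can be counted and summed by
  the points of their horizontal strands.\<close>

lemma bij_inversions:
  assumes \<mu>: "\<mu> \<in> strands_of Z h"
  shows "bij_betw (\<lambda>c. fst (snd c)) (inversions (\<mu> \<union> Id_on U)) (U \<inter> inside \<mu>)"
  unfolding bij_betw_def inversions_add_horizontals[OF \<mu>]
proof
  show "inj_on (\<lambda>c. fst (snd c))
      {((a, b), (p, p)) | a b p. (a, b) \<in> \<mu> \<and> p \<in> U \<and> point_less a p \<and> point_less p b}"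
  proof (rule inj_onI)
    fix c c' :: "(point \<times> point) \<times> (point \<times> point)"
    let ?R = "{((a, b), (p, p)) | a b p. (a, b) \<in> \<mu> \<and> p \<in> U \<and> point_less a p \<and> point_less p b}"
    assume "c \<in> ?R" "c' \<in> ?R" and eq: "fst (snd c) = fst (snd c')"
    then obtain a b p a' b' p' where c: "c = ((a, b), (p, p))" "(a, b) \<in> \<mu>" "point_less a p" "point_less p b"
      and c': "c' = ((a', b'), (p', p'))" "(a', b') \<in> \<mu>" "point_less a' p'" "point_less p' b'"
      by blast
    have p: "p = p'" using eq c(1) c'(1) by simp
    then have "a = a' \<and> b = b'"
      using cover_unique[OF \<mu> c(2) c'(2)] covers_interior[OF c(3,4)] covers_interior[OF c'(3,4)] by blast
    then show "c = c'" using c(1) c'(1) p by simp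
  qed
  show "(\<lambda>c. fst (snd c)) ` {((a, b), (p, p)) | a b p. (a, b) \<in> \<mu> \<and> p \<in> U \<and> point_less a p \<and> point_less p b} =
    U \<inter> inside \<mu>"
    unfolding inside_def by force
qed

lemma inv_number_add_horizontals:
  "\<mu> \<in> strands_of Z h \<Longrightarrow> inv_number (\<mu> \<union> Id_on U) = card (U \<inter> inside \<mu>)"
  unfolding inv_number_def by (rule bij_betw_same_card[OF bij_inversions])

lemma resolve_add_horizontals:
  assumes \<mu>: "\<mu> \<in> strands_of Z h" and c: "c \<in> inversions (\<mu> \<union> Id_on U)"
  shows "resolve (\<mu> \<union> Id_on U) c = break_at (fst (snd c)) \<mu> \<union> Id_on (U - {fst (snd c)})"
proof -
  obtain a b p where c: "c = ((a, b), (p, p))" and ab: "(a, b) \<in> \<mu>" "point_less a p" "point_less p b"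
    using c unfolding inversions_add_horizontals[OF \<mu>] by blast
  have "(a, b) \<notin> Id_on U"
    using point_less_trans[OF ab(2,3)] point_less_irrefl by blast
  moreover have "(p, p) \<notin> \<mu>"
    using strands_less[OF \<mu>, of p p] point_less_irrefl by blast
  ultimately show ?thesis unfolding c resolve.simps fst_conv snd_conv break_at_eq(1)[OF \<mu> ab] by blast
qed

lemma finite_inside: "\<mu> \<in> strands_of Z h \<Longrightarrow> finite (inside \<mu>)"
  using inside_through[of \<mu>] finite_places[of Z] by (auto simp: through_def intro: finite_subset)

text \<open>The condition on crossing numbers in \<open>strand_diff\<close> always holds: resolving
  at p removes p from both U and \<open>inside\<close>, so exactly one crossing disappears.\<close>

lemma strand_diff_add_horizontals:
  assumes \<mu>: "\<mu> \<in> strands_of Z h"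
  shows "strand_diff (\<mu> \<union> Id_on U) = (\<Sum>p\<in>U \<inter> inside \<mu>. single (break_at p \<mu> \<union> Id_on (U - {p})))"
proof -
  let ?D = "\<mu> \<union> Id_on U"
  have "inv_number ?D = inv_number (resolve ?D c) + 1" if c: "c \<in> inversions ?D" for c
  proof -
    let ?p = "fst (snd c)"
    have p: "?p \<in> U \<inter> inside \<mu>" using bij_betwE[OF bij_inversions[OF \<mu>]] c by blast
    then have i: "?p \<in> inside \<mu>" by blast
    have "(U - {?p}) \<inter> (inside \<mu> - {?p}) = U \<inter> inside \<mu> - {?p}" by blast
    then have "inv_number (resolve ?D c) = card (U \<inter> inside \<mu> - {?p})"
      by (simp only: resolve_add_horizontals[OF \<mu> c] inside_break_at[OF \<mu> i]
          inv_number_add_horizontals[OF break_at_strands[OF \<mu> i]])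
    moreover have "finite (U \<inter> inside \<mu>)" using finite_inside[OF \<mu>] by simp
    ultimately show ?thesis
      using p inv_number_add_horizontals[OF \<mu>] by (metis Suc_eq_plus1 card.remove)
  qed
  then have "{c \<in> inversions ?D. inv_number ?D = inv_number (resolve ?D c) + 1} = inversions ?D" by blast
  then have "strand_diff ?D = (\<Sum>c\<in>inversions ?D. single (break_at (fst (snd c)) \<mu> \<union> Id_on (U - {fst (snd c)})))"
    unfolding strand_diff_def using resolve_add_horizontals[OF \<mu>] by (intro sum.cong) auto
  also have "\<dots> = (\<Sum>p\<in>U \<inter> inside \<mu>. single (break_at p \<mu> \<union> Id_on (U - {p})))"
    by (rule sum.reindex_bij_betw[OF bij_inversions[OF \<mu>]])
  finally show ?thesis .
qed

end

section \<open>The diagrams with given H-data\<close>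

lemma sections_label: "S \<in> sections Z s \<Longrightarrow> p \<in> S \<Longrightarrow> p \<in> places Z \<Longrightarrow> label Z p \<in> s"
  by (auto simp: sections_def)

lemma sections_unique:
  assumes "S \<in> sections Z s" "p \<in> S" "q \<in> S" "p \<in> places Z" "q \<in> places Z" "label Z p = label Z q"
  shows "p = q"
proof -
  have "\<exists>!r. r \<in> S \<inter> places_of Z (label Z p)"
    using assms(1) sections_label[OF assms(1,2,4)] unfolding sections_def by blast
  moreover have "p \<in> S \<inter> places_of Z (label Z p)" "q \<in> S \<inter> places_of Z (label Z p)"
    using assms(2-6) by (simp_all add: places_of_def)
  ultimately show ?thesis by blast
qed

lemma sections_ex:
  assumes "S \<in> sections Z s" "P \<in> s"
  obtains r where "r \<in> S" "r \<in> places Z" "label Z r = P"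
  using assms unfolding sections_def places_of_def by blast

text \<open>Used to move a horizontal strand to the other place of its matched pair.\<close>

lemma sections_swap:
  assumes S: "S \<in> sections Z s" and q: "q \<in> S" "q \<in> places Z"
    and p: "p \<in> places Z" "label Z p = label Z q"
  shows "insert p (S - {q}) \<in> sections Z s"
proof (cases "p = q")
  case True
  then show ?thesis using S q by (simp add: insert_absorb)
next
  case False
  let ?T = "insert p (S - {q})"
  have "?T \<subseteq> points Z" using S p(1) places_points unfolding sections_def by blast
  moreover have "label Z ` (?T \<inter> places Z) \<subseteq> s"
  proof -
    have "label Z q \<in> s" by (rule sections_label[OF S q])
    moreover have "label Z ` (S \<inter> places Z) \<subseteq> s" using S by (simp add: sections_def)
    ultimately show ?thesis using p(2) by auto
  qed
  moreover have "\<exists>!r. r \<in> ?T \<inter> places_of Z P" if P: "P \<in> s" for P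
  proof (cases "P = label Z q")
    case True
    have "r = p" if "r \<in> ?T \<inter> places_of Z P" for r
    proof (rule ccontr)
      assume "r \<noteq> p"
      then have "r \<in> S" "r \<noteq> q" "r \<in> places Z" "label Z r = label Z q"
        using that True by (auto simp: places_of_def)
      then show False using sections_unique[OF S _ q(1) _ q(2)] by blast
    qed
    moreover have "p \<in> ?T \<inter> places_of Z P" using p True by (simp add: places_of_def)
    ultimately show ?thesis by blast
  next
    case False
    have "?T \<inter> places_of Z P = S \<inter> places_of Z P"
      using False p(2) by (auto simp: places_of_def)
    then show ?thesis using S P unfolding sections_def by simp
  qed
  ultimately show ?thesis by (simp add: sections_def)
qed

locale viable_hdata = viable_class Z h for Z h +
  fixes s t :: "nat set"
  assumes arc: "arc_diagram Z" and s: "s \<subseteq> pairs Z" and t: "t \<subseteq> pairs Z"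
begin

lemma partner:
  assumes "p \<in> places Z"
  obtains q where "q \<in> places Z" "q \<noteq> p" "label Z q = label Z p" "places_of Z (label Z p) = {p, q}"
proof -
  have "label Z p \<in> pairs Z" using arc assms by (auto simp: arc_diagram_def)
  then have "card (places_of Z (label Z p)) = 2" using arc by (simp add: arc_diagram_def)
  then obtain x y where xy: "places_of Z (label Z p) = {x, y}" "x \<noteq> y" unfolding card_2_iff by blast
  have "p \<in> {x, y}" using assms unfolding xy(1)[symmetric] by (simp add: places_of_def)
  then have "\<exists>q. places_of Z (label Z p) = {p, q} \<and> q \<noteq> p"
    using xy(2) unfolding xy(1) by blast
  then obtain q where q: "places_of Z (label Z p) = {p, q}" "q \<noteq> p" by blast
  then have "q \<in> places_of Z (label Z p)" by blast
  then have "q \<in> places Z" "label Z q = label Z p" by (simp_all add: places_of_def)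
  then show thesis using q(2,1) by (intro that[of q])
qed

abbreviation V :: "strands \<Rightarrow> point set set" where
  "V \<mu> \<equiv> horizontals Z s \<mu> t"

abbreviation R :: "nat set" where
  "R \<equiv> all_on_once Z h s t \<union> all_on_doubly Z h s t"

text \<open>The vertices: one place of each all-on once occupied pair (\<open>once_vertex\<close>),
  both places of each all-on doubly occupied pair (\<open>doubly_vertices\<close>).\<close>

definition F :: "point set" where
  "F = {p \<in> through. label Z p \<in> R}"

lemma F_places: "p \<in> F \<Longrightarrow> p \<in> places Z"
  by (simp add: F_def through_def)

lemma finite_F: "finite F"
  by (rule finite_subset[OF _ finite_places[of Z]]) (use F_places in blast)

lemma V_disjoint: "U \<in> V \<mu> \<Longrightarrow> p \<in> U \<Longrightarrow> p \<notin> Domain \<mu> \<and> p \<notin> Range \<mu> \<and> p \<in> points Z"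
  by (auto simp: horizontals_def)

lemma V_sections: "U \<in> V \<mu> \<Longrightarrow> Domain \<mu> \<union> U \<in> sections Z s \<and> Range \<mu> \<union> U \<in> sections Z t"
  by (simp add: horizontals_def)

section \<open>Places that can carry breaks or crossed horizontal strands\<close>

lemma V_join:
  assumes \<mu>: "\<mu> \<in> strands_of Z h" and p: "p \<in> breaks \<mu>" and U: "U \<in> V \<mu>"
  shows "insert p U \<in> V (join_at p \<mu>)"
proof -
  have D: "p \<in> Domain \<mu>" "p \<in> Range \<mu>" using breaks_iff[OF \<mu>] p by auto
  then have "Domain \<mu> - {p} \<union> insert p U = Domain \<mu> \<union> U" "Range \<mu> - {p} \<union> insert p U = Range \<mu> \<union> U"
    by blast+
  moreover have "p \<in> points Z" using p by (simp add: breaks_def through_def places_points)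
  ultimately show ?thesis using U
    unfolding horizontals_def Domain_join_at[OF \<mu> p] Range_join_at[OF \<mu> p] by auto
qed

lemma V_break:
  assumes \<mu>: "\<mu> \<in> strands_of Z h" and p: "p \<in> inside \<mu>" "p \<in> U" and U: "U \<in> V \<mu>"
  shows "U - {p} \<in> V (break_at p \<mu>)"
proof -
  have "insert p (Domain \<mu>) \<union> (U - {p}) = Domain \<mu> \<union> U" "insert p (Range \<mu>) \<union> (U - {p}) = Range \<mu> \<union> U"
    using p(2) by blast+
  then show ?thesis using U
    unfolding horizontals_def Domain_break_at[OF \<mu> p(1)] Range_break_at[OF \<mu> p(1)] by auto
qed

lemma V_swap:
  assumes U: "U \<in> V \<mu>" and q: "q \<in> U" "q \<in> places Z" and p: "p \<in> places Z" "label Z p = label Z q"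
    and "p \<notin> Domain \<mu>" "p \<notin> Range \<mu>"
  shows "insert p (U - {q}) \<in> V \<mu>"
proof -
  have "q \<notin> Domain \<mu>" "q \<notin> Range \<mu>" using V_disjoint[OF U q(1)] by auto
  then have "Domain \<mu> \<union> insert p (U - {q}) = insert p (Domain \<mu> \<union> U - {q})"
    "Range \<mu> \<union> insert p (U - {q}) = insert p (Range \<mu> \<union> U - {q})" by blast+
  moreover have "insert p (Domain \<mu> \<union> U - {q}) \<in> sections Z s" "insert p (Range \<mu> \<union> U - {q}) \<in> sections Z t"
    using sections_swap[OF _ _ q(2) p] V_sections[OF U] q(1) by blast+
  moreover have "p \<in> points Z" using p(1) by (rule places_points)
  ultimately show ?thesis using U assms(6,7) unfolding horizontals_def by auto
qed

lemma not_endpoint_cases: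
  assumes \<mu>: "\<mu> \<in> strands_of Z h" and p: "p \<in> places Z" "p \<notin> Domain \<mu>" "p \<notin> Range \<mu>"
  shows "h p = 1 \<and> h (step_before p) = 1 \<and> p \<in> inside \<mu> \<or> h p = 0 \<and> h (step_before p) = 0"
proof -
  have "1 \<le> snd p" using p(1) by (auto simp: places_def)
  then have "(h p = 1 \<longrightarrow> p \<in> inside \<mu>) \<and> (h (step_before p) = 1 \<longrightarrow> p \<in> inside \<mu>)"
    using Domain_strands_iff[OF \<mu>] Range_strands_iff[OF \<mu>] p by blast
  moreover have "p \<in> inside \<mu> \<longrightarrow> h p = 1 \<and> h (step_before p) = 1"
    using inside_through[OF \<mu>] by (auto simp: through_def)
  ultimately show ?thesis using h_cases[OF \<mu>, of p] h_cases[OF \<mu>, of "step_before p"] by blast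
qed

lemma R_iff:
  assumes p: "p \<in> places Z" "q \<in> places Z" "q \<noteq> p" "places_of Z (label Z p) = {p, q}"
    and h: "h p = 1" "h (step_before p) = 1"
    and st: "label Z p \<in> s" "label Z p \<in> t"
  shows "label Z p \<in> all_on_once Z h s t \<longleftrightarrow> h q = 0 \<and> h (step_before q) = 0"
    and "label Z p \<in> all_on_doubly Z h s t \<longleftrightarrow> h q = 1 \<and> h (step_before q) = 1"
proof -
  have pairs: "label Z p \<in> pairs Z" using st(1) s by blast
  have "once_occupied_at Z h (label Z p) p" if "h q = 0 \<and> h (step_before q) = 0"
    unfolding once_occupied_at_def using p(3,4) h that by (intro exI[of _ q]) (auto simp: step_after_def)
  moreover have "h q = 0 \<and> h (step_before q) = 0" if "once_occupied_at Z h (label Z p) p'" for p'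
    using that h p(3,4) unfolding once_occupied_at_def by (auto simp: step_after_def doubleton_eq_iff)
  ultimately show "label Z p \<in> all_on_once Z h s t \<longleftrightarrow> h q = 0 \<and> h (step_before q) = 0"
    using pairs st unfolding all_on_once_def by blast
  show "label Z p \<in> all_on_doubly Z h s t \<longleftrightarrow> h q = 1 \<and> h (step_before q) = 1"
    using pairs st h p(4) by (auto simp: all_on_doubly_def doubly_occupied_def step_after_def)
qed

text \<open>A section has only one place of each pair, so no strand starts or ends at the partner q
  of p. Hence h covers both or neither of the steps at q, and the pair is doubly or once
  occupied.\<close>

lemma mem_F:
  assumes \<mu>: "\<mu> \<in> strands_of Z h" and U: "U \<in> V \<mu>"
    and p: "p \<in> through" "p \<in> Domain \<mu> \<union> U" "p \<in> Range \<mu> \<union> U"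
  shows "p \<in> F"
proof -
  have pl: "p \<in> places Z" using p(1) by (simp add: through_def)
  obtain q where q: "q \<in> places Z" "q \<noteq> p" "label Z q = label Z p" "places_of Z (label Z p) = {p, q}"
    using partner[OF pl] by blast
  note S = V_sections[OF U, THEN conjunct1] and T = V_sections[OF U, THEN conjunct2]
  have st: "label Z p \<in> s" "label Z p \<in> t" using sections_label[OF S p(2) pl] sections_label[OF T p(3) pl] .
  have "q \<notin> Domain \<mu> \<union> U" "q \<notin> Range \<mu> \<union> U"
    using sections_unique[OF S p(2) _ pl q(1)] sections_unique[OF T p(3) _ pl q(1)] q(2,3) by metis+
  then have "h q = 1 \<and> h (step_before q) = 1 \<or> h q = 0 \<and> h (step_before q) = 0"
    using not_endpoint_cases[OF \<mu> q(1)] by blast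
  moreover have "h p = 1" "h (step_before p) = 1" using p(1) by (simp_all add: through_def)
  ultimately have "label Z p \<in> R" using R_iff[OF pl q(1,2,4) _ _ st] by blast
  then show ?thesis using p(1) by (simp add: F_def)
qed

lemma breaks_D:
  assumes "\<mu> \<in> strands_of Z h" "p \<in> breaks \<mu>"
  shows "p \<in> Domain \<mu>" "p \<in> Range \<mu>" "p \<in> places Z" "p \<in> through"
proof -
  show "p \<in> Domain \<mu>" "p \<in> Range \<mu>" using breaks_iff[OF assms(1)] assms(2) by blast+
  show "p \<in> places Z" "p \<in> through" using assms(2) by (simp_all add: breaks_def through_def)
qed

lemma breaks_faces:
  assumes \<mu>: "\<mu> \<in> strands_of Z h" and U: "U \<in> V \<mu>"
  shows "breaks \<mu> \<in> faces F (label Z)"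
proof -
  have "p \<in> F" if "p \<in> breaks \<mu>" for p
    using mem_F[OF \<mu> U breaks_D(4)[OF \<mu> that]] breaks_D(1,2)[OF \<mu> that] by blast
  moreover have "inj_on (label Z) (breaks \<mu>)"
  proof (rule inj_onI)
    fix p q assume "p \<in> breaks \<mu>" "q \<in> breaks \<mu>" "label Z p = label Z q"
    then show "p = q"
      using sections_unique[of "Domain \<mu> \<union> U" Z s p q] V_sections[OF U] breaks_D[OF \<mu>] by blast
  qed
  ultimately show ?thesis by (auto simp: faces_def)
qed

lemma horizontal_inside:
  assumes \<mu>: "\<mu> \<in> strands_of Z h" and U: "U \<in> V \<mu>" and p: "p \<in> U" "p \<in> inside \<mu>"
  shows "p \<in> F" and "label Z p \<notin> label Z ` breaks \<mu>"
proof -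
  show F: "p \<in> F" using mem_F[OF \<mu> U] p inside_through[OF \<mu>] by blast
  show "label Z p \<notin> label Z ` breaks \<mu>"
  proof
    assume "label Z p \<in> label Z ` breaks \<mu>"
    then obtain b where b: "b \<in> breaks \<mu>" "label Z p = label Z b" by blast
    then have "b \<in> Domain \<mu>" "b \<in> places Z"
      using breaks_D[OF \<mu>] by blast+
    then have "p = b"
      using sections_unique[of "Domain \<mu> \<union> U" Z s p b] V_sections[OF U] p(1) F_places[OF F] b(2) by blast
    then show False using V_disjoint[OF U p(1)] \<open>b \<in> Domain \<mu>\<close> by blast
  qed
qed

text \<open>The pair of p lies in s, so one of its places r is the start of a moving or horizontal
  strand. A moving strand starting at r would make r a break with the label of p. So r is
  horizontal, and its strand can be moved to p.\<close>

lemma ex_horizontal: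
  assumes \<mu>: "\<mu> \<in> strands_of Z h" and U: "U \<in> V \<mu>" and p: "p \<in> F" "label Z p \<notin> label Z ` breaks \<mu>"
  shows "p \<in> inside \<mu>" and "\<exists>U'\<in>V \<mu>. p \<in> U'"
proof -
  have pl: "p \<in> places Z" using F_places[OF p(1)] .
  have thr: "p \<in> through" "label Z p \<in> R" using p(1) by (simp_all add: F_def)
  then have hp: "h p = 1" "h (step_before p) = 1" by (simp_all add: through_def)
  show ins: "p \<in> inside \<mu>" using thr p(2) by (auto simp: breaks_def)
  then have out: "p \<notin> Domain \<mu>" "p \<notin> Range \<mu>" using Domain_strands_iff[OF \<mu>] Range_strands_iff[OF \<mu>] by blast+
  have st: "label Z p \<in> s" "label Z p \<in> t" using thr(2) by (auto simp: all_on_once_def all_on_doubly_def)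
  note S = V_sections[OF U, THEN conjunct1]
  obtain r where r: "r \<in> Domain \<mu> \<union> U" "r \<in> places Z" "label Z r = label Z p"
    using sections_ex[OF S st(1)] by blast
  have "r \<notin> Domain \<mu>"
  proof
    assume rD: "r \<in> Domain \<mu>"
    then have hr: "h r = 1" using Domain_strands_iff[OF \<mu>] by blast
    have "r \<noteq> p" using rD out by blast
    obtain q where q: "q \<in> places Z" "q \<noteq> p" "label Z q = label Z p" "places_of Z (label Z p) = {p, q}"
      using partner[OF pl] by blast
    have "r \<in> places_of Z (label Z p)" using r by (simp add: places_of_def)
    then have "r = q" using q(4) \<open>r \<noteq> p\<close> by blast
    \<comment> \<open>The step leaving r is covered, so the pair is not once occupied. It is then
      doubly occupied, which covers the step before r too.\<close>
    then have "h (step_before r) = 1" using R_iff[OF pl q(1,2,4) hp st] thr(2) hr by auto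
    then have "r \<in> breaks \<mu>"
      using rD hr r(2) Domain_strands_iff[OF \<mu>] by (auto simp: breaks_def through_def)
    then show False using p(2) r(3) by (metis imageI)
  qed
  then have "r \<in> U" using r(1) by blast
  then have "insert p (U - {r}) \<in> V \<mu>" using V_swap[OF U _ r(2) pl _ out] r(3) by simp
  then show "\<exists>U'\<in>V \<mu>. p \<in> U'" by blast
qed

section \<open>Diagrams and their differential in terms of faces\<close>

definition M :: "strands set" where
  "M = {\<mu> \<in> strands_of Z h. V \<mu> \<noteq> {}}"

lemma M_eq: "moving_strands_of Z h s t = M"
  unfolding moving_strands_of_def M_def strands_of_def
  using diagram_nonzero_iff by auto

lemma finite_M: "finite M"
  using finite_strands_of by (auto simp: M_def intro: finite_subset)

lemma M_strands: "\<mu> \<in> M \<Longrightarrow> \<mu> \<in> strands_of Z h"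
  by (simp add: M_def)

lemma M_moving: "\<mu> \<in> M \<Longrightarrow> \<mu> \<in> moving_strands Z"
  by (simp add: M_def strands_of_def)

lemma M_join: "\<mu> \<in> M \<Longrightarrow> p \<in> breaks \<mu> \<Longrightarrow> join_at p \<mu> \<in> M"
  using V_join join_at_strands unfolding M_def by blast

lemma M_break:
  assumes "\<mu> \<in> M" "p \<in> F" "label Z p \<notin> label Z ` breaks \<mu>"
  shows "p \<in> inside \<mu>" and "break_at p \<mu> \<in> M"
proof -
  obtain U where U: "U \<in> V \<mu>" and \<mu>: "\<mu> \<in> strands_of Z h" using assms(1) by (auto simp: M_def)
  show i: "p \<in> inside \<mu>" by (rule ex_horizontal(1)[OF \<mu> U assms(2,3)])
  obtain U' where U': "U' \<in> V \<mu>" "p \<in> U'" using ex_horizontal(2)[OF \<mu> U assms(2,3)] by blast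
  show "break_at p \<mu> \<in> M" using V_break[OF \<mu> i U'(2,1)] break_at_strands[OF \<mu> i] by (auto simp: M_def)
qed

lemma breaks_M: "\<mu> \<in> M \<Longrightarrow> breaks \<mu> \<in> faces F (label Z)"
  using breaks_faces unfolding M_def by blast

text \<open>\<open>M\<close> is closed under joining at breaks and under breaking at vertices with
  new labels. Joining at all breaks of some member reaches the empty face, and breaking at one
  vertex after another then reaches any given face.\<close>

lemma bij_breaks:
  assumes "M \<noteq> {}"
  shows "bij_betw breaks M (faces F (label Z))"
  unfolding bij_betw_def
proof
  show "inj_on breaks M"
    by (rule inj_onI) (rule strands_eqI_breaks[OF M_strands M_strands])
  have "\<exists>\<nu>\<in>M. breaks \<nu> = {}" if "\<mu> \<in> M" "finite B" "breaks \<mu> = B" for \<mu> B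
    using that(2,1,3)
  proof (induction B arbitrary: \<mu> rule: finite_induct)
    case empty
    then show ?case by blast
  next
    case (insert p B)
    then have p: "p \<in> breaks \<mu>" by blast
    have "breaks (join_at p \<mu>) = B"
      using insert.prems insert.hyps breaks_join_at[OF M_strands p] by simp
    then show ?case using insert.IH M_join[OF insert.prems(1) p] by blast
  qed
  moreover obtain \<mu> where "\<mu> \<in> M" using assms by blast
  moreover have "finite (breaks \<mu>)" if "\<mu> \<in> M" for \<mu>
    using breaks_M[OF that] finite_F by (auto simp: faces_def intro: finite_subset)
  ultimately obtain \<nu> where \<nu>: "\<nu> \<in> M" "breaks \<nu> = {}" by blast
  have "\<exists>\<mu>\<in>M. breaks \<mu> = B" if "finite B" "B \<in> faces F (label Z)" for B
    using that
  proof (induction B rule: finite_induct)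
    case empty
    then show ?case using \<nu> by blast
  next
    case (insert p B)
    then have "B \<in> faces F (label Z)" and p: "p \<in> F" "label Z p \<notin> label Z ` B"
      by (auto simp: faces_def)
    then obtain \<mu> where \<mu>: "\<mu> \<in> M" "breaks \<mu> = B" using insert.IH by blast
    have p': "label Z p \<notin> label Z ` breaks \<mu>" using p(2) \<mu>(2) by simp
    have "breaks (break_at p \<mu>) = insert p B"
      using breaks_break_at[OF M_strands[OF \<mu>(1)] M_break(1)[OF \<mu>(1) p(1) p']] \<mu>(2) by simp
    then show ?case using M_break(2)[OF \<mu>(1) p(1) p'] by blast
  qed
  moreover have "finite B" if "B \<in> faces F (label Z)" for B
    using that finite_F by (auto simp: faces_def intro: finite_subset)
  ultimately have "faces F (label Z) \<subseteq> breaks ` M" by blast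
  moreover have "breaks ` M \<subseteq> faces F (label Z)" using breaks_M by blast
  ultimately show "breaks ` M = faces F (label Z)" by blast
qed

abbreviation D :: "strands \<Rightarrow> chain" where
  "D \<mu> \<equiv> diagram Z s \<mu> t"

lemma D_eq: "\<mu> \<in> M \<Longrightarrow> D \<mu> = indicator ((\<lambda>U. \<mu> \<union> Id_on U) ` V \<mu>)"
  using diagram_eq M_moving by blast

text \<open>The terms are sorted by the point p of the resolved crossing. The remaining horizontal
  strands then run exactly once through \<open>V (break_at p \<mu>)\<close>, so the terms for p add
  up to a single diagram.\<close>

lemma diff_D:
  assumes \<mu>: "\<mu> \<in> M"
  shows "diff Z (D \<mu>) = (\<Sum>p\<in>{p \<in> F. label Z p \<notin> label Z ` breaks \<mu>}. D (break_at p \<mu>))"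
proof -
  note str = M_strands[OF \<mu>]
  let ?f = "\<lambda>\<mu> U. \<mu> \<union> Id_on U"
  let ?N = "{p \<in> F. label Z p \<notin> label Z ` breaks \<mu>}"
  have inj: "inj_on (?f \<nu>) W" if "\<nu> \<in> M" for \<nu> W
    using inj_add_horizontals[OF M_moving[OF that]] by (rule inj_on_subset) simp
  have D_single: "D \<nu> = (\<Sum>U\<in>V \<nu>. single (?f \<nu> U))" if "\<nu> \<in> M" for \<nu>
    unfolding D_eq[OF that] by (rule sum_single[OF finite_horizontals inj[OF that], symmetric])
  have "?f \<mu> ` V \<mu> \<subseteq> strand_diagrams Z"
    using moving_strand_diagrams[OF M_moving[OF \<mu>]] by (auto simp: horizontals_def)
  then have "diff Z (D \<mu>) = (\<Sum>U\<in>V \<mu>. strand_diff (?f \<mu> U))"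
    by (simp add: D_eq[OF \<mu>] diff_indicator sum.reindex[OF inj[OF \<mu>]])
  also have "\<dots> = (\<Sum>U\<in>V \<mu>. \<Sum>p\<in>U \<inter> inside \<mu>. single (?f (break_at p \<mu>) (U - {p})))"
    by (simp only: strand_diff_add_horizontals[OF str])
  also have "\<dots> = (\<Sum>(U, p)\<in>(SIGMA U:V \<mu>. U \<inter> inside \<mu>). single (?f (break_at p \<mu>) (U - {p})))"
    by (rule sum.Sigma) (simp_all add: finite_horizontals finite_inside[OF str])
  also have "\<dots> = (\<Sum>(p, W)\<in>(SIGMA p:?N. V (break_at p \<mu>)). single (?f (break_at p \<mu>) W))"
  proof (rule sum.reindex_bij_witness[where i = "\<lambda>(p, W). (insert p W, p)" and j = "\<lambda>(U, p). (p, U - {p})"])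
    fix a assume "a \<in> (SIGMA U:V \<mu>. U \<inter> inside \<mu>)"
    then obtain U p where a: "a = (U, p)" "U \<in> V \<mu>" "p \<in> U" "p \<in> inside \<mu>" by blast
    show "(\<lambda>(p, W). (insert p W, p)) ((\<lambda>(U, p). (p, U - {p})) a) = a"
      using a by (simp add: insert_absorb)
    show "(\<lambda>(U, p). (p, U - {p})) a \<in> (SIGMA p:?N. V (break_at p \<mu>))"
      using a horizontal_inside[OF str a(2-4)] V_break[OF str a(4,3,2)] by simp
    show "(case (\<lambda>(U, p). (p, U - {p})) a of (p, W) \<Rightarrow> single (?f (break_at p \<mu>) W)) =
        (case a of (U, p) \<Rightarrow> single (?f (break_at p \<mu>) (U - {p})))"
      using a(1) by simp
  next
    fix b assume "b \<in> (SIGMA p:?N. V (break_at p \<mu>))"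
    then obtain p W where b: "b = (p, W)" "p \<in> F" "label Z p \<notin> label Z ` breaks \<mu>" "W \<in> V (break_at p \<mu>)"
      by blast
    have i: "p \<in> inside \<mu>" by (rule M_break(1)[OF \<mu> b(2,3)])
    have "p \<in> Domain (break_at p \<mu>)" using Domain_break_at[OF str i] by simp
    then have pW: "p \<notin> W" using V_disjoint[OF b(4)] by blast
    show "(\<lambda>(U, p). (p, U - {p})) ((\<lambda>(p, W). (insert p W, p)) b) = b"
      using b(1) pW by simp
    have "p \<in> breaks (break_at p \<mu>)" using breaks_break_at[OF str i] by simp
    then have "insert p W \<in> V (join_at p (break_at p \<mu>))"
      by (rule V_join[OF break_at_strands[OF str i] _ b(4)])
    then show "(\<lambda>(p, W). (insert p W, p)) b \<in> (SIGMA U:V \<mu>. U \<inter> inside \<mu>)"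
      using b(1) i by (simp add: join_at_break_at[OF str i])
  qed
  also have "\<dots> = (\<Sum>p\<in>?N. \<Sum>W\<in>V (break_at p \<mu>). single (?f (break_at p \<mu>) W))"
    using finite_F by (intro sum.Sigma[symmetric]) (simp_all add: finite_horizontals)
  also have "\<dots> = (\<Sum>p\<in>?N. D (break_at p \<mu>))"
    using D_single M_break(2)[OF \<mu>] by (intro sum.cong) simp_all
  finally show ?thesis .
qed

lemma label_F: "label Z ` F = R"
proof
  show "label Z ` F \<subseteq> R" by (auto simp: F_def)
  show "R \<subseteq> label Z ` F"
  proof
    fix P assume P: "P \<in> R"
    have "\<exists>p. p \<in> places_of Z P \<and> h p = 1 \<and> h (step_before p) = 1"
    proof (cases "P \<in> all_on_once Z h s t")
      case True
      then show ?thesis by (auto simp: all_on_once_def once_occupied_at_def step_after_def)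
    next
      case False
      then have "doubly_occupied Z h P" "P \<in> pairs Z" using P by (auto simp: all_on_doubly_def)
      moreover from this have "places_of Z P \<noteq> {}" using arc by (auto simp: arc_diagram_def)
      ultimately show ?thesis by (auto simp: doubly_occupied_def step_after_def)
    qed
    then show "P \<in> label Z ` F" using P by (auto simp: F_def through_def places_of_def)
  qed
qed

text \<open>If a pair in \<open>R\<close> has no break, a horizontal strand can be placed at any of
  its vertices, and a moving strand passes over it. A pair with a break carries no horizontal
  strand.\<close>

lemma crossed_pairs_D:
  assumes \<mu>: "\<mu> \<in> M"
  shows "crossed_pairs Z (D \<mu>) = R - label Z ` breaks \<mu>"
proof -
  note str = M_strands[OF \<mu>]
  have supp: "D \<mu> E \<noteq> 0 \<longleftrightarrow> (\<exists>U\<in>V \<mu>. E = \<mu> \<union> Id_on U)" for E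
    by (auto simp: D_eq[OF \<mu>] indicator_def)
  have inv: "(\<exists>f. ((p, p), f) \<in> inversions (\<mu> \<union> Id_on U) \<or> (f, (p, p)) \<in> inversions (\<mu> \<union> Id_on U)) \<longleftrightarrow>
      p \<in> U \<and> p \<in> inside \<mu>" for p U
  proof -
    have "(p, p) \<notin> \<mu>" using strands_less[OF str] point_less_irrefl by blast
    then show ?thesis unfolding inversions_add_horizontals[OF str] inside_def by blast
  qed
  have "crossed_pairs Z (D \<mu>) =
      {label Z p | p. p \<in> places Z \<and> (\<exists>U\<in>V \<mu>. \<exists>f. ((p, p), f) \<in> inversions (\<mu> \<union> Id_on U) \<or>
        (f, (p, p)) \<in> inversions (\<mu> \<union> Id_on U))}"
    unfolding crossed_pairs_def supp by blast
  also have "\<dots> = {label Z p | p. p \<in> places Z \<and> (\<exists>U\<in>V \<mu>. p \<in> U \<and> p \<in> inside \<mu>)}"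
    by (simp only: inv)
  also have "\<dots> = R - label Z ` breaks \<mu>"
  proof (intro equalityI subsetI)
    fix P assume "P \<in> {label Z p | p. p \<in> places Z \<and> (\<exists>U\<in>V \<mu>. p \<in> U \<and> p \<in> inside \<mu>)}"
    then obtain p U where p: "P = label Z p" "U \<in> V \<mu>" "p \<in> U" "p \<in> inside \<mu>" by blast
    have "label Z p \<in> label Z ` F" by (rule imageI) (rule horizontal_inside(1)[OF str p(2-4)])
    then show "P \<in> R - label Z ` breaks \<mu>"
      using horizontal_inside(2)[OF str p(2-4)] label_F p(1) by simp
  next
    fix P assume P: "P \<in> R - label Z ` breaks \<mu>"
    then have "P \<in> label Z ` F" using label_F by blast
    then obtain p where p: "p \<in> F" "label Z p = P" by blast
    obtain U where U: "U \<in> V \<mu>" using \<mu> by (auto simp: M_def)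
    have "p \<in> inside \<mu>" "\<exists>U'\<in>V \<mu>. p \<in> U'" using ex_horizontal[OF str U p(1)] P p(2) by auto
    then show "P \<in> {label Z p | p. p \<in> places Z \<and> (\<exists>U\<in>V \<mu>. p \<in> U \<and> p \<in> inside \<mu>)}"
      using p F_places by blast
  qed
  finally show ?thesis .
qed

lemma inj_on_D: "inj_on D M" and independent_D: "chain.independent (D ` M)"
proof -
  let ?X = "\<lambda>\<mu>. (\<lambda>U. \<mu> \<union> Id_on U) ` V \<mu>"
  have ne: "?X \<mu> \<noteq> {}" if "\<mu> \<in> M" for \<mu> using that by (simp add: M_def)
  \<comment> \<open>The strands that are not horizontal recover \<mu> from any summand, so distinct
    diagrams have disjoint supports.\<close>
  have rec: "{(x, y) \<in> E. x \<noteq> y} = \<mu>" if "\<mu> \<in> M" "E \<in> ?X \<mu>" for \<mu> E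
    using that M_moving[OF that(1)] unfolding moving_strands_def by blast
  have disj: "?X \<mu> \<inter> ?X \<nu> = {}" if "\<mu> \<in> M" "\<nu> \<in> M" "\<mu> \<noteq> \<nu>" for \<mu> \<nu>
    using rec[OF that(1)] rec[OF that(2)] that(3) by blast
  have "inj_on (\<lambda>\<mu>. indicator (?X \<mu>) :: chain) M" "chain.independent ((\<lambda>\<mu>. indicator (?X \<mu>)) ` M)"
    by (rule independent_indicators[of M ?X]; fact finite_M ne disj)+
  then show "inj_on D M" "chain.independent (D ` M)"
    using D_eq by (auto simp: inj_on_def cong: image_cong)
qed

end

section \<open>Creation operators and the passage to the face complex\<close>

lemma independent_maps:
  assumes fin: "finite I" and inj: "inj_on (\<lambda>i. G i v) I"
    and ind: "chain.independent ((\<lambda>i. G i v) ` I)"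
  shows "inj_on G I" and "chain_map.independent (G ` I)"
proof -
  show injG: "inj_on G I"
    using inj by (auto simp: inj_on_def)
  show "chain_map.independent (G ` I)"
  proof
    assume "chain_map.dependent (G ` I)"
    then obtain f j where sum: "(\<Sum>x\<in>G ` I. map_scale (f x) x) = 0" and j: "j \<in> I" "f (G j) \<noteq> 0"
      using chain_map.dependent_finite[of "G ` I"] fin by auto
    have "(\<Sum>i\<in>I. map_scale (f (G i)) (G i)) = 0"
      using sum by (simp add: sum.reindex[OF injG])
    \<comment> \<open>A relation among the maps, evaluated at v, becomes a relation among their
      values.\<close>
    then have "(\<Sum>i\<in>I. map_scale (f (G i)) (G i)) v = 0" by simp
    then have "(\<Sum>i\<in>I. chain_scale (f (G i)) (G i v)) = 0"
      by (simp add: sum_fun_apply map_scale_def)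
    moreover define u where "u w = f (G (inv_into I (\<lambda>i. G i v) w))" for w
    have u: "u (G i v) = f (G i)" if "i \<in> I" for i
      using inv_into_f_f[OF inj that] by (simp add: u_def)
    ultimately have "(\<Sum>w\<in>(\<lambda>i. G i v) ` I. chain_scale (u w) w) = 0"
      by (simp add: sum.reindex[OF inj])
    from chain.independentD[OF ind _ _ this, of "G j v"] have "u (G j v) = 0"
      using fin j(1) by simp
    then show False using j(2) unfolding u[OF j(1)] by contradiction
  qed
qed

lemma span_of_dim:
  assumes "finite B" "chain_map.independent B"
  shows "vector_space_of_dim (chain_map.span B) (card B)"
  using chain_map_bit.card_span[OF assms] chain_map.dim_span_eq_card_independent[OF assms(2)]
  by (simp add: vector_space_of_dim_def)

context viable_hdata
begin

lemma onceE:
  assumes "P \<in> all_on_once Z h s t"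
  obtains r q where "once_occupied_at Z h P r" "places_of Z P = {r, q}" "h q = 0"
proof -
  obtain r where r: "once_occupied_at Z h P r" using assms unfolding all_on_once_def by blast
  then obtain q where "places_of Z P = {r, q}" "h (step_after q) = 0"
    unfolding once_occupied_at_def by blast
  then show thesis using r that[of r q] by (simp add: step_after_def)
qed

lemma once_occupied_iff:
  assumes "P \<in> all_on_once Z h s t"
  shows "once_occupied_at Z h P p \<longleftrightarrow> p \<in> F \<and> label Z p = P"
proof
  assume o: "once_occupied_at Z h P p"
  then have "p \<in> places_of Z P" unfolding once_occupied_at_def by blast
  then show "p \<in> F \<and> label Z p = P"
    using o assms by (auto simp: once_occupied_at_def F_def through_def places_of_def step_after_def)
next
  assume p: "p \<in> F \<and> label Z p = P"
  obtain r q where r: "once_occupied_at Z h P r" "places_of Z P = {r, q}" "h q = 0"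
    using onceE[OF assms] .
  have "p \<in> places_of Z P" "h p = 1" using p by (auto simp: F_def through_def places_of_def)
  then have "p = r" using r(2,3) by auto
  then show "once_occupied_at Z h P p" using r(1) by simp
qed

text \<open>This provides the apex of the contraction and justifies the definite description in
  \<open>creation\<close>.\<close>

lemma once_vertex:
  assumes "P \<in> all_on_once Z h s t"
  shows "{p \<in> F. label Z p = P} = {THE p. once_occupied_at Z h P p}"
proof -
  obtain r q where r: "once_occupied_at Z h P r" and q: "places_of Z P = {r, q}" "h q = 0"
    using onceE[OF assms] .
  have unique: "p = r" if "once_occupied_at Z h P p" for p
  proof -
    have "p \<in> places_of Z P" "h p = 1" using that by (auto simp: once_occupied_at_def step_after_def)
    then show ?thesis using q by auto
  qed
  have "(THE p. once_occupied_at Z h P p) = r" using r unique by (rule the_equality)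
  then show ?thesis using once_occupied_iff[OF assms] r unique by blast
qed

lemma doubly_vertices:
  assumes "P \<in> all_on_doubly Z h s t"
  shows "card {p \<in> F. label Z p = P} = 2"
proof -
  have "{p \<in> F. label Z p = P} = places_of Z P"
    using assms by (auto simp: F_def through_def places_of_def all_on_doubly_def doubly_occupied_def step_after_def)
  moreover have "P \<in> pairs Z" using s assms by (auto simp: all_on_doubly_def)
  ultimately show ?thesis using arc by (simp add: arc_diagram_def)
qed

lemma once_doubly_disjoint: "all_on_once Z h s t \<inter> all_on_doubly Z h s t = {}"
proof -
  have False if "P \<in> all_on_once Z h s t" "P \<in> all_on_doubly Z h s t" for P
    using once_vertex[OF that(1)] doubly_vertices[OF that(2)] by simp
  then show ?thesis by blast
qed

text \<open>The basis of diagrams reindexed by faces; by \<open>bij_breaks\<close> every face has a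
  diagram once \<open>M\<close> is nonempty.\<close>

definition E :: "point set \<Rightarrow> chain" where
  "E B = D (inv_into M breaks B)"

lemma E_breaks:
  assumes "\<mu> \<in> M"
  shows "E (breaks \<mu>) = D \<mu>"
proof -
  have "M \<noteq> {}" using assms by blast
  then have "inj_on breaks M" using bij_breaks by (simp add: bij_betw_def)
  then show ?thesis using assms by (simp add: E_def)
qed

lemma face_strands:
  assumes "M \<noteq> {}" "B \<in> faces F (label Z)"
  obtains \<mu> where "\<mu> \<in> M" "breaks \<mu> = B"
proof -
  have "B \<in> breaks ` M" using bij_breaks[OF assms(1)] assms(2) by (simp add: bij_betw_def)
  then show thesis using that by blast
qed

lemma face_complex_E:
  assumes M: "M \<noteq> {}"
  shows "face_complex F (label Z) E (diff Z)"
proof (rule face_complex.intro)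
  show "finite F" by (rule finite_F)
  show "Vector_Spaces.linear chain_scale chain_scale (diff Z)" by (rule linear_diff)
  have img: "E ` faces F (label Z) = D ` M"
  proof -
    have "E ` breaks ` M = D ` M" unfolding image_image using E_breaks by (rule image_cong[OF refl])
    then show ?thesis using bij_breaks[OF M] by (simp add: bij_betw_def)
  qed
  show "chain.independent (E ` faces F (label Z))" unfolding img by (rule independent_D)
  show "inj_on E (faces F (label Z))"
  proof (rule inj_onI)
    fix B C assume B: "B \<in> faces F (label Z)" and C: "C \<in> faces F (label Z)" and eq: "E B = E C"
    obtain \<mu> where \<mu>: "\<mu> \<in> M" "breaks \<mu> = B" using face_strands[OF M B] .
    obtain \<nu> where \<nu>: "\<nu> \<in> M" "breaks \<nu> = C" using face_strands[OF M C] .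
    have "D \<mu> = D \<nu>" using eq E_breaks[OF \<mu>(1)] E_breaks[OF \<nu>(1)] \<mu>(2) \<nu>(2) by simp
    then have "\<mu> = \<nu>" using inj_onD[OF inj_on_D] \<mu>(1) \<nu>(1) by blast
    then show "B = C" using \<mu>(2) \<nu>(2) by simp
  qed
  fix B assume B: "B \<in> faces F (label Z)"
  obtain \<mu> where \<mu>: "\<mu> \<in> M" "breaks \<mu> = B" using face_strands[OF M B] .
  have "D (break_at p \<mu>) = E (insert p B)" if p: "p \<in> F" "label Z p \<notin> label Z ` B" for p
  proof -
    have p': "label Z p \<notin> label Z ` breaks \<mu>" using p(2) \<mu>(2) by simp
    have "breaks (break_at p \<mu>) = insert p B"
      using breaks_break_at[OF M_strands[OF \<mu>(1)] M_break(1)[OF \<mu>(1) p(1) p']] \<mu>(2) by simp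
    then show ?thesis using E_breaks[OF M_break(2)[OF \<mu>(1) p(1) p']] by simp
  qed
  then show "diff Z (E B) = (\<Sum>p\<in>{p \<in> F. label Z p \<notin> label Z ` B}. E (insert p B))"
    using diff_D[OF \<mu>(1)] E_breaks[OF \<mu>(1)] \<mu>(2) by simp
qed

text \<open>The crossed pairs are the labels missing from \<open>breaks\<close>, so their number is
  the grade of the face.\<close>

lemma level_eq:
  assumes M: "M \<noteq> {}"
  shows "level Z h s t n = face_complex.A F (label Z) E n"
proof -
  interpret face_complex F "label Z" E "diff Z" by (rule face_complex_E[OF M])
  have crossed: "card (crossed_pairs Z (D \<mu>)) = n \<longleftrightarrow> breaks \<mu> \<in> grade n" if \<mu>: "\<mu> \<in> M" for \<mu>
  proof -
    have B: "breaks \<mu> \<subseteq> F" "inj_on (label Z) (breaks \<mu>)" using breaks_M[OF \<mu>] by (simp_all add: faces_def)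
    have fin: "finite (label Z ` F)" using finite_F by simp
    have sub: "label Z ` breaks \<mu> \<subseteq> label Z ` F" using B(1) by blast
    have "card (crossed_pairs Z (D \<mu>)) = card (label Z ` F) - card (breaks \<mu>)"
      unfolding crossed_pairs_D[OF \<mu>] label_F[symmetric]
      using card_Diff_subset[OF finite_subset[OF sub fin] sub] card_image[OF B(2)] by simp
    moreover have "card (breaks \<mu>) \<le> card (label Z ` F)"
      using card_mono[OF fin sub] card_image[OF B(2)] by simp
    ultimately show ?thesis using breaks_M[OF \<mu>] by (auto simp: grade_def)
  qed
  have "{v \<in> diagrams Z h s t. card (crossed_pairs Z v) = n} = D ` {\<mu> \<in> M. breaks \<mu> \<in> grade n}"
    unfolding diagrams_def M_eq using crossed by blast
  also have "\<dots> = E ` breaks ` {\<mu> \<in> M. breaks \<mu> \<in> grade n}"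
    unfolding image_image using E_breaks by (intro image_cong) auto
  also have "breaks ` {\<mu> \<in> M. breaks \<mu> \<in> grade n} = grade n"
  proof -
    have "grade n \<subseteq> breaks ` M" using bij_breaks[OF M] grade_faces by (simp add: bij_betw_def)
    then show ?thesis by blast
  qed
  finally show ?thesis by (simp add: level_def A_def)
qed

lemma inverting_homs_of_dim:
  assumes M: "M \<noteq> {}" and once: "all_on_once Z h s t \<noteq> {}"
  defines "z \<equiv> \<lambda>n. \<Sum>k\<le>card (all_on_doubly Z h s t). (card (all_on_doubly Z h s t) choose k) *
    ((card (all_on_once Z h s t) + k - 1) choose n)"
  shows "affine_space_of_dim (inverting_homs Z h s t n) (z n * z (Suc n))"
proof -
  interpret face_complex F "label Z" E "diff Z" by (rule face_complex_E[OF M])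
  obtain P where P: "P \<in> all_on_once Z h s t" using once by blast
  obtain p where p: "{p \<in> F. label Z p = P} = {p}" using once_vertex[OF P] by blast
  then have pF: "p \<in> F" "label Z p = P" by blast+
  interpret contractible_face_complex F "label Z" E "diff Z" p
    using p pF by unfold_locales blast+
  have "chain.dim (cycles m) = z m" for m
    unfolding z_def
  proof (rule dim_cycles)
    show "label Z p \<in> all_on_once Z h s t" using P pF(2) by simp
    show "\<exists>x. {x \<in> F. label Z x = Q} = {x}" if "Q \<in> all_on_once Z h s t" for Q
      using once_vertex[OF that] by blast
  qed (use label_F once_doubly_disjoint doubly_vertices in auto)
  moreover have "level_cycles Z h s t n = cycles n"
    by (simp add: level_cycles_def cycles_def level_eq[OF M])
  ultimately show ?thesis
    using inverting_maps_of_dim[of n] by (simp add: inverting_homs_def level_eq[OF M])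
qed

lemma creation_D:
  assumes \<mu>: "\<mu> \<in> M" "crossed_pairs Z (D \<mu>) = {}"
  shows "creation Z h s t P (D \<mu>) = D (join_at (THE p. once_occupied_at Z h P p) \<mu>)"
proof -
  let ?c = "create Z s t P (THE p. once_occupied_at Z h P p)"
  have "creation Z h s t P (D \<mu>) =
      (\<Sum>\<nu>\<in>M. chain_scale (chain.representation (D ` M) (D \<mu>) (D \<nu>)) (?c \<nu>))"
    by (simp add: creation_def diagrams_def M_eq)
  \<comment> \<open>The coordinates of a basis vector form a delta function, so only the summand of
    \<mu> survives.\<close>
  also have "chain.representation (D ` M) (D \<mu>) = (\<lambda>v. if v = D \<mu> then 1 else 0)"
    using chain.representation_basis[OF independent_D] \<mu>(1) by blast
  also have "(\<Sum>\<nu>\<in>M. chain_scale (if D \<nu> = D \<mu> then 1 else 0) (?c \<nu>)) = (\<Sum>\<nu>\<in>M. if \<nu> = \<mu> then ?c \<mu> else 0)"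
    using inj_on_eq_iff[OF inj_on_D _ \<mu>(1)] by (intro sum.cong) auto
  also have "\<dots> = ?c \<mu>" using finite_M \<mu>(1) by simp
  finally show ?thesis using \<mu>(2) by (simp add: create_def)
qed

text \<open>All creation operators are compared on one crossingless diagram. It has a break at the
  vertex of every all-on once occupied pair, and joining at different vertices yields different
  basis diagrams.\<close>

lemma creations_of_dim:
  assumes \<mu>: "\<mu> \<in> M" "crossed_pairs Z (D \<mu>) = {}"
  shows "vector_space_of_dim (chain_map.span (creation Z h s t ` all_on_once Z h s t))
    (card (all_on_once Z h s t))"
proof -
  let ?U = "all_on_once Z h s t" and ?p = "\<lambda>P. THE p. once_occupied_at Z h P p"
  have fin: "finite ?U" using finite_F label_F by (metis finite_Un finite_imageI)
  have vertex: "?p P \<in> F \<and> label Z (?p P) = P" if "P \<in> ?U" for P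
    using once_vertex[OF that] by blast
  have p_breaks: "?p P \<in> breaks \<mu>" if P: "P \<in> ?U" for P
  proof -
    have "P \<in> label Z ` breaks \<mu>" using P \<mu>(2) crossed_pairs_D[OF \<mu>(1)] by blast
    then obtain p where p: "p \<in> breaks \<mu>" "label Z p = P" by blast
    then have "p \<in> F" using breaks_M[OF \<mu>(1)] by (auto simp: faces_def)
    then have "p = ?p P" using once_vertex[OF P] p(2) by blast
    then show ?thesis using p(1) by simp
  qed
  have join: "join_at (?p P) \<mu> \<in> M" "breaks (join_at (?p P) \<mu>) = breaks \<mu> - {?p P}" if "P \<in> ?U" for P
    using M_join[OF \<mu>(1)] breaks_join_at[OF M_strands[OF \<mu>(1)]] p_breaks[OF that] by blast+
  have eq: "creation Z h s t P (D \<mu>) = D (join_at (?p P) \<mu>)" for P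
    by (rule creation_D[OF \<mu>])
  have inj: "inj_on (\<lambda>P. creation Z h s t P (D \<mu>)) ?U"
  proof (rule inj_onI)
    fix P Q assume P: "P \<in> ?U" and Q: "Q \<in> ?U" and "creation Z h s t P (D \<mu>) = creation Z h s t Q (D \<mu>)"
    then have "join_at (?p P) \<mu> = join_at (?p Q) \<mu>"
      unfolding eq using inj_onD[OF inj_on_D] join(1) by blast
    then have "breaks \<mu> - {?p P} = breaks \<mu> - {?p Q}" using join(2)[OF P] join(2)[OF Q] by simp
    then have "?p P = ?p Q" using p_breaks[OF P] p_breaks[OF Q] by blast
    then have "label Z (?p P) = label Z (?p Q)" by (rule arg_cong)
    then show "P = Q" unfolding vertex[OF P, THEN conjunct2] vertex[OF Q, THEN conjunct2] .
  qed
  have "(\<lambda>P. creation Z h s t P (D \<mu>)) ` ?U \<subseteq> D ` M" unfolding eq using join(1) by blast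
  then have "chain.independent ((\<lambda>P. creation Z h s t P (D \<mu>)) ` ?U)"
    using chain.independent_mono[OF independent_D] by blast
  note G = independent_maps[where G = "creation Z h s t" and v = "D \<mu>", OF fin inj this]
  show ?thesis using span_of_dim[OF _ G(2)] fin card_image[OF G(1)] by simp
qed

end

text \<open>The sums may stop at L since \<open>L choose k\<close> vanishes beyond, and N \<ge> 1
  keeps the natural number N + k - 1 from being truncated.\<close>

theorem proposition3p13:
  fixes Z :: arc and h :: hclass and s t :: "nat set" and L N n :: nat
  assumes "arc_diagram Z"
    and "twisted_hdata Z h s t"
    and "card (all_on_doubly Z h s t) = L"
    and "card (all_on_once Z h s t) = N"
    and "N \<ge> 1"
  shows "affine_space_of_dim (inverting_homs Z h s t n)
           ((\<Sum>k\<le>L. (L choose k) * ((N + k - 1) choose n)) *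
            (\<Sum>k\<le>L. (L choose k) * ((N + k - 1) choose (n + 1)))) \<and>
         vector_space_of_dim (chain_map.span (creation Z h s t ` all_on_once Z h s t)) N"
proof -
  interpret viable_hdata Z h s t
    using assms(1,2) by unfold_locales (simp_all add: twisted_hdata_def hdata_def)
  obtain v where v: "v \<in> diagrams Z h s t" "crossingless v"
    using assms(2) by (auto simp: twisted_hdata_def)
  \<comment> \<open>The crossingless diagram shows that \<open>M\<close> is nonempty, and it is the
    one on which the creation operators are compared.\<close>
  then obtain \<mu> where \<mu>: "\<mu> \<in> M" "v = D \<mu>" by (auto simp: diagrams_def M_eq)
  then have "crossed_pairs Z (D \<mu>) = {}"
    using v(2) unfolding crossed_pairs_def crossingless_def by blast
  then have "vector_space_of_dim (chain_map.span (creation Z h s t ` all_on_once Z h s t)) N"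
    using creations_of_dim[OF \<mu>(1)] assms(4) by simp
  moreover have "all_on_once Z h s t \<noteq> {}" using assms(4,5) by auto
  ultimately show ?thesis
    using inverting_homs_of_dim[of n] \<mu>(1) assms(3,4) by auto
qed

end
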